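(* Let $(X,\mathcal B)$ be an uncountable standard Borel space. (1) For every $T\in Aut(X,\mathcal B)$, the full group $[T]$ is closed in $Aut(X,\mathcal B)$ with respect to each of the topologies $\tau,\tau',\tau'',p,\tilde p,\overline p$. (2) For every $T\in\widehat{Aut}(X,\mathcal B)$, the full group $[T]$ (a subgroup of $\widehat{Aut}(X,\mathcal B)$) is closed in $\widehat{Aut}(X,\mathcal B)$ with respect to $\hat\tau$.
   Context: $Aut(X,\mathcal B)$ is the group of all one-to-one Borel automorphisms of $X$. $\mathcal M_1(X)$ is the set of Borel probability measures on $X$. $B(X)$ is the space of bounded real-valued Borel functions with the sup norm $\|\cdot\|$, and $B(X)_1=\{f\in B(X):\|f\|\le 1\}$. For $S,T\in Aut(X,\mathcal B)$, $E(S,T)=\{x: Tx\ne Sx\}\cup\{x: T^{-1}x\ne S^{-1}x\}$, and $\mu\circ S(f)=\int_X f(S^{-1}x)\,d\mu(x)$. The topologies are given by the following bases of neighborhoods ($T\in Aut(X,\mathcal B)$, $\mu_j\in\mathcal M_1(X)$, $F_i\in\mathcal B$, $f_i\in B(X)$, $\varepsilon>0$, finite families): $\tau$: $\{S:\mu_j(E(S,T))<\varepsilon,\ j=1,\dots,n\}$; $\tau'$: $\{S:\sup_{F\in\mathcal B}\mu_j(TF\,\Delta\, SF)<\varepsilon,\ j=1,\dots,n\}$; $\tau''$: $\{S:\sup_{f\in B(X)_1}|\mu_j\circ S(f)-\mu_j\circ T(f)|<\varepsilon,\ j=1,\dots,n\}$; $p$: $\{S: SF_i=TF_i,\ i=1,\dots,k\}$;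 $\tilde p$: $\{S:\|f_i\circ T^{-1}-f_i\circ S^{-1}\|<\varepsilon,\ i=1,\dots,m\}$; $\overline p$: $\{S:\mu_j(SF_i\,\Delta\, TF_i)+\mu_j(S^{-1}F_i\,\Delta\, T^{-1}F_i)<\varepsilon\ \text{for all } i\le k, j\le n\}$. The full group of $T\in Aut(X,\mathcal B)$ is $[T]=\{\gamma\in Aut(X,\mathcal B):\gamma x\in Orb_T(x)\ \forall x\in X\}$, where $Orb_T(x)=\{T^nx:n\in\mathbb Z\}$. $Ctbl(X)$ is the normal subgroup of $T\in Aut(X,\mathcal B)$ with $\{x:Tx\ne x\}$ at most countable; $\widehat{Aut}(X,\mathcal B)=Aut(X,\mathcal B)/Ctbl(X)$, i.e. automorphisms that differ on an at most countable set are identified; $\hat\tau$ is the quotient topology of $\tau$. For $T\in\widehat{Aut}(X,\mathcal B)$ (represented by an automorphism again denoted $T$), $[T]$ is the set of classes in $\widehat{Aut}(X,\mathcal B)$ of automorphisms $\gamma$ such that $\gamma x\in Orb_T(x)$ for all $x$ outside an at most countable set. *)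

theory Defs
  imports
    "HOL-Analysis.Analysis"
    "HOL-Probability.Giry_Monad"
    "HOL-Algebra.Bij"
    "HOL-Algebra.Coset"
begin

text \<open>
  A Borel space is represented by a measure \<open>M\<close> of which only \<open>space M\<close> and \<open>sets M\<close> matter.
  It is standard if its \<open>\<sigma>\<close>-algebra is the Borel \<open>\<sigma>\<close>-algebra of a Polish topology, i.e. of a
  separable completely metrizable one.
\<close>

definition standard_borel :: "'a measure \<Rightarrow> bool" where
  "standard_borel M \<longleftrightarrow>
     (\<exists>X. topspace X = space M \<and> completely_metrizable_space X \<and>
          (\<exists>D. countable D \<and> D \<subseteq> topspace X \<and> X closure_of D = topspace X) \<and>
          sets M = sigma_sets (space M) {U. openin X U})"

text \<open>
  Automorphisms are extensional functions (\<^const>\<open>Bij\<close>), so that two of them are equal as soon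
  as they agree on \<open>space M\<close>. The second measurability condition concerns the inverse map.
\<close>

definition borel_aut :: "'a measure \<Rightarrow> ('a \<Rightarrow> 'a) set" where
  "borel_aut M = {T \<in> Bij (space M). T \<in> M \<rightarrow>\<^sub>M M \<and> inv_into (space M) T \<in> M \<rightarrow>\<^sub>M M}"

definition Aut :: "'a measure \<Rightarrow> ('a \<Rightarrow> 'a) monoid" where
  "Aut M = (BijGroup (space M))\<lparr>carrier := borel_aut M\<rparr>"

abbreviation ainv :: "'a measure \<Rightarrow> ('a \<Rightarrow> 'a) \<Rightarrow> 'a \<Rightarrow> 'a" where
  "ainv M T \<equiv> inv\<^bsub>Aut M\<^esub> T"

definition prob_measures :: "'a measure \<Rightarrow> 'a measure set" where
  "prob_measures M = {\<mu>. prob_space \<mu> \<and> sets \<mu> = sets M}"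

definition bounded_borel :: "'a measure \<Rightarrow> ('a \<Rightarrow> real) set" where
  "bounded_borel M = {f \<in> borel_measurable M. bounded (f ` space M)}"

definition sup_norm :: "'a measure \<Rightarrow> ('a \<Rightarrow> real) \<Rightarrow> real" where
  "sup_norm M f = (SUP x\<in>space M. \<bar>f x\<bar>)"

definition bounded_borel1 :: "'a measure \<Rightarrow> ('a \<Rightarrow> real) set" where
  "bounded_borel1 M = {f \<in> bounded_borel M. sup_norm M f \<le> 1}"

definition diff_set :: "'a measure \<Rightarrow> ('a \<Rightarrow> 'a) \<Rightarrow> ('a \<Rightarrow> 'a) \<Rightarrow> 'a set" where
  "diff_set M S T = {x \<in> space M. T x \<noteq> S x} \<union> {x \<in> space M. ainv M T x \<noteq> ainv M S x}"

definition push_integral :: "'a measure \<Rightarrow> 'a measure \<Rightarrow> ('a \<Rightarrow> 'a) \<Rightarrow> ('a \<Rightarrow> real) \<Rightarrow> real" where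
  "push_integral M \<mu> S f = (\<integral>x. f (ainv M S x) \<partial>\<mu>)"


subsection \<open>Topologies on the automorphism group\<close>

definition tau_nbhd :: "'a measure \<Rightarrow> ('a \<Rightarrow> 'a) \<Rightarrow> 'a measure set \<Rightarrow> real \<Rightarrow> ('a \<Rightarrow> 'a) set" where
  "tau_nbhd M T \<M> \<epsilon> = {S \<in> borel_aut M. \<forall>\<mu>\<in>\<M>. measure \<mu> (diff_set M S T) < \<epsilon>}"

definition tau'_nbhd :: "'a measure \<Rightarrow> ('a \<Rightarrow> 'a) \<Rightarrow> 'a measure set \<Rightarrow> real \<Rightarrow> ('a \<Rightarrow> 'a) set" where
  "tau'_nbhd M T \<M> \<epsilon> =
     {S \<in> borel_aut M. \<forall>\<mu>\<in>\<M>. (SUP F\<in>sets M. measure \<mu> (sym_diff (T ` F) (S ` F))) < \<epsilon>}"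

definition tau''_nbhd :: "'a measure \<Rightarrow> ('a \<Rightarrow> 'a) \<Rightarrow> 'a measure set \<Rightarrow> real \<Rightarrow> ('a \<Rightarrow> 'a) set" where
  "tau''_nbhd M T \<M> \<epsilon> =
     {S \<in> borel_aut M. \<forall>\<mu>\<in>\<M>.
        (SUP f\<in>bounded_borel1 M. \<bar>push_integral M \<mu> S f - push_integral M \<mu> T f\<bar>) < \<epsilon>}"

definition p_nbhd :: "'a measure \<Rightarrow> ('a \<Rightarrow> 'a) \<Rightarrow> 'a set set \<Rightarrow> ('a \<Rightarrow> 'a) set" where
  "p_nbhd M T \<F> = {S \<in> borel_aut M. \<forall>F\<in>\<F>. S ` F = T ` F}"

definition p_tilde_nbhd :: "'a measure \<Rightarrow> ('a \<Rightarrow> 'a) \<Rightarrow> ('a \<Rightarrow> real) set \<Rightarrow> real \<Rightarrow> ('a \<Rightarrow> 'a) set" where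
  "p_tilde_nbhd M T \<Phi> \<epsilon> =
     {S \<in> borel_aut M. \<forall>f\<in>\<Phi>. sup_norm M (\<lambda>x. f (ainv M T x) - f (ainv M S x)) < \<epsilon>}"

definition p_bar_nbhd ::
  "'a measure \<Rightarrow> ('a \<Rightarrow> 'a) \<Rightarrow> 'a set set \<Rightarrow> 'a measure set \<Rightarrow> real \<Rightarrow> ('a \<Rightarrow> 'a) set" where
  "p_bar_nbhd M T \<F> \<M> \<epsilon> =
     {S \<in> borel_aut M. \<forall>F\<in>\<F>. \<forall>\<mu>\<in>\<M>.
        measure \<mu> (sym_diff (S ` F) (T ` F)) +
        measure \<mu> (sym_diff (ainv M S ` F) (ainv M T ` F)) < \<epsilon>}"

text \<open>
  Each family of basic neighbourhoods comes from (pseudo)metrics, or from equalities in the case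
  of \<open>p\<close>; on a standard Borel space it is a base of the topology it generates, and the members
  around a given \<open>T\<close> are a neighbourhood base at \<open>T\<close>.
\<close>

definition tau :: "'a measure \<Rightarrow> ('a \<Rightarrow> 'a) topology" where
  "tau M = topology_generated_by
     {tau_nbhd M T \<M> \<epsilon> | T \<M> \<epsilon>. T \<in> borel_aut M \<and> finite \<M> \<and> \<M> \<subseteq> prob_measures M \<and> \<epsilon> > 0}"

definition tau' :: "'a measure \<Rightarrow> ('a \<Rightarrow> 'a) topology" where
  "tau' M = topology_generated_by
     {tau'_nbhd M T \<M> \<epsilon> | T \<M> \<epsilon>. T \<in> borel_aut M \<and> finite \<M> \<and> \<M> \<subseteq> prob_measures M \<and> \<epsilon> > 0}"

definition tau'' :: "'a measure \<Rightarrow> ('a \<Rightarrow> 'a) topology" where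
  "tau'' M = topology_generated_by
     {tau''_nbhd M T \<M> \<epsilon> | T \<M> \<epsilon>. T \<in> borel_aut M \<and> finite \<M> \<and> \<M> \<subseteq> prob_measures M \<and> \<epsilon> > 0}"

definition p_top :: "'a measure \<Rightarrow> ('a \<Rightarrow> 'a) topology" where
  "p_top M = topology_generated_by
     {p_nbhd M T \<F> | T \<F>. T \<in> borel_aut M \<and> finite \<F> \<and> \<F> \<subseteq> sets M}"

definition p_tilde :: "'a measure \<Rightarrow> ('a \<Rightarrow> 'a) topology" where
  "p_tilde M = topology_generated_by
     {p_tilde_nbhd M T \<Phi> \<epsilon> | T \<Phi> \<epsilon>. T \<in> borel_aut M \<and> finite \<Phi> \<and> \<Phi> \<subseteq> bounded_borel M \<and> \<epsilon> > 0}"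

definition p_bar :: "'a measure \<Rightarrow> ('a \<Rightarrow> 'a) topology" where
  "p_bar M = topology_generated_by
     {p_bar_nbhd M T \<F> \<M> \<epsilon> | T \<F> \<M> \<epsilon>.
        T \<in> borel_aut M \<and> finite \<F> \<and> \<F> \<subseteq> sets M \<and> finite \<M> \<and> \<M> \<subseteq> prob_measures M \<and> \<epsilon> > 0}"


subsection \<open>Full groups\<close>

definition Orb :: "'a measure \<Rightarrow> ('a \<Rightarrow> 'a) \<Rightarrow> 'a \<Rightarrow> 'a set" where
  "Orb M T x = {(T [^]\<^bsub>Aut M\<^esub> n) x | n :: int. True}"

definition full_group :: "'a measure \<Rightarrow> ('a \<Rightarrow> 'a) \<Rightarrow> ('a \<Rightarrow> 'a) set" where
  "full_group M T = {\<gamma> \<in> borel_aut M. \<forall>x\<in>space M. \<gamma> x \<in> Orb M T x}"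


subsection \<open>The quotient by automorphisms with countable support\<close>

definition Ctbl :: "'a measure \<Rightarrow> ('a \<Rightarrow> 'a) set" where
  "Ctbl M = {T \<in> borel_aut M. countable {x \<in> space M. T x \<noteq> x}}"

definition Aut_hat :: "'a measure \<Rightarrow> ('a \<Rightarrow> 'a) set monoid" where
  "Aut_hat M = Aut M Mod Ctbl M"

definition hat_class :: "'a measure \<Rightarrow> ('a \<Rightarrow> 'a) \<Rightarrow> ('a \<Rightarrow> 'a) set" where
  "hat_class M T = Ctbl M #>\<^bsub>Aut M\<^esub> T"

definition quotient_topology :: "'a topology \<Rightarrow> ('a \<Rightarrow> 'b) \<Rightarrow> 'b topology" where
  "quotient_topology X f =
     topology (\<lambda>U. U \<subseteq> f ` topspace X \<and> openin X {x \<in> topspace X. f x \<in> U})"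

definition tau_hat :: "'a measure \<Rightarrow> ('a \<Rightarrow> 'a) set topology" where
  "tau_hat M = quotient_topology (tau M) (hat_class M)"

text \<open>Here \<open>T\<close> is a representative of an element of \<^const>\<open>Aut_hat\<close>.\<close>

definition full_group_hat :: "'a measure \<Rightarrow> ('a \<Rightarrow> 'a) \<Rightarrow> ('a \<Rightarrow> 'a) set set" where
  "full_group_hat M T =
     {hat_class M \<gamma> | \<gamma>. \<gamma> \<in> borel_aut M \<and> countable {x \<in> space M. \<gamma> x \<notin> Orb M T x}}"


subsection \<open>Well-definedness\<close>

lemma inv_BijGroup_eq:
  assumes "T \<in> Bij S"
  shows "inv\<^bsub>BijGroup S\<^esub> T = restrict (inv_into S T) S"
proof -
  interpret group "BijGroup S" by (rule group_BijGroup)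
  have "restrict (inv_into S T) S \<otimes>\<^bsub>BijGroup S\<^esub> T = \<one>\<^bsub>BijGroup S\<^esub>"
    using assms Bij_compose_restrict_eq[OF assms] restrict_inv_into_Bij[OF assms]
    by (simp add: BijGroup_def)
  then show ?thesis
    using assms restrict_inv_into_Bij[OF assms]
    by (intro inv_equality) (auto simp: BijGroup_def)
qed

lemma borel_aut_subgroup: "subgroup (borel_aut M) (BijGroup (space M))"
proof -
  let ?S = "space M"
  interpret B: group "BijGroup ?S" by (rule group_BijGroup)
  have invinv: "restrict (inv_into ?S (restrict (inv_into ?S T) ?S)) ?S = T" if "T \<in> Bij ?S" for T
  proof -
    have "inv\<^bsub>BijGroup ?S\<^esub> (inv\<^bsub>BijGroup ?S\<^esub> T) = T"
      using that by (intro B.inv_inv) (simp add: BijGroup_def)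
    then show ?thesis
      using that restrict_inv_into_Bij[OF that] by (simp add: inv_BijGroup_eq)
  qed
  have meas_iff: "inv_into ?S T \<in> M \<rightarrow>\<^sub>M M \<longleftrightarrow> restrict (inv_into ?S T) ?S \<in> M \<rightarrow>\<^sub>M M" for T
    by (intro measurable_cong) simp
  show ?thesis
  proof (rule B.subgroupI)
    show "borel_aut M \<subseteq> carrier (BijGroup ?S)"
      by (auto simp: borel_aut_def BijGroup_def)
    have "inv_into ?S (\<lambda>x\<in>?S. x) x = x" if "x \<in> ?S" for x
      using that by (intro inv_into_f_eq) (auto simp: inj_on_def)
    then have "inv_into ?S (\<lambda>x\<in>?S. x) \<in> M \<rightarrow>\<^sub>M M \<longleftrightarrow> (\<lambda>x. x) \<in> M \<rightarrow>\<^sub>M M"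
      by (intro measurable_cong)
    moreover have "(\<lambda>x\<in>?S. x) \<in> M \<rightarrow>\<^sub>M M \<longleftrightarrow> (\<lambda>x. x) \<in> M \<rightarrow>\<^sub>M M"
      by (intro measurable_cong) simp
    ultimately have "(\<lambda>x\<in>?S. x) \<in> borel_aut M"
      using id_Bij[of ?S] by (auto simp: borel_aut_def)
    then show "borel_aut M \<noteq> {}" by blast
  next
    fix T assume T: "T \<in> borel_aut M"
    then have B: "T \<in> Bij ?S" and m: "T \<in> M \<rightarrow>\<^sub>M M" "restrict (inv_into ?S T) ?S \<in> M \<rightarrow>\<^sub>M M"
      using meas_iff[of T] by (auto simp: borel_aut_def)
    have "restrict (inv_into ?S (restrict (inv_into ?S T) ?S)) ?S \<in> M \<rightarrow>\<^sub>M M"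
      using invinv[OF B] m by simp
    then show "inv\<^bsub>BijGroup ?S\<^esub> T \<in> borel_aut M"
      using B m restrict_inv_into_Bij[OF B] meas_iff[of "restrict (inv_into ?S T) ?S"]
      by (auto simp: borel_aut_def inv_BijGroup_eq)
  next
    fix T U assume "T \<in> borel_aut M" "U \<in> borel_aut M"
    then have B: "T \<in> Bij ?S" "U \<in> Bij ?S" and m: "T \<in> M \<rightarrow>\<^sub>M M" "U \<in> M \<rightarrow>\<^sub>M M"
      and i: "restrict (inv_into ?S T) ?S \<in> M \<rightarrow>\<^sub>M M" "restrict (inv_into ?S U) ?S \<in> M \<rightarrow>\<^sub>M M"
      using meas_iff[of T] meas_iff[of U] by (auto simp: borel_aut_def)
    have c: "compose ?S g f \<in> M \<rightarrow>\<^sub>M M" if "g \<in> M \<rightarrow>\<^sub>M M" "f \<in> M \<rightarrow>\<^sub>M M" for f g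
    proof -
      have "compose ?S g f \<in> M \<rightarrow>\<^sub>M M \<longleftrightarrow> (\<lambda>x. g (f x)) \<in> M \<rightarrow>\<^sub>M M"
        by (intro measurable_cong) (simp add: compose_def)
      then show ?thesis using measurable_compose[OF that(2) that(1)] by simp
    qed
    have mult: "g \<otimes>\<^bsub>BijGroup ?S\<^esub> f = compose ?S g f" if "g \<in> Bij ?S" "f \<in> Bij ?S" for f g
      using that by (simp add: BijGroup_def)
    have TU: "compose ?S T U \<in> Bij ?S" using B by (rule compose_Bij)
    have "inv\<^bsub>BijGroup ?S\<^esub> (T \<otimes>\<^bsub>BijGroup ?S\<^esub> U) =
        inv\<^bsub>BijGroup ?S\<^esub> U \<otimes>\<^bsub>BijGroup ?S\<^esub> inv\<^bsub>BijGroup ?S\<^esub> T"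
      using B by (intro B.inv_mult_group) (auto simp: BijGroup_def)
    then have "restrict (inv_into ?S (compose ?S T U)) ?S =
        compose ?S (restrict (inv_into ?S U) ?S) (restrict (inv_into ?S T) ?S)"
      using B TU by (simp add: mult inv_BijGroup_eq restrict_inv_into_Bij)
    then have "inv_into ?S (compose ?S T U) \<in> M \<rightarrow>\<^sub>M M"
      using c[OF i(2) i(1)] meas_iff[of "compose ?S T U"] by simp
    then show "T \<otimes>\<^bsub>BijGroup ?S\<^esub> U \<in> borel_aut M"
      using TU c[OF m] by (simp add: borel_aut_def mult[OF B])
  qed
qed

lemma group_Aut: "group (Aut M)"
  unfolding Aut_def by (rule group.subgroup_imp_group[OF group_BijGroup borel_aut_subgroup])

lemma carrier_Aut: "carrier (Aut M) = borel_aut M"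
  by (simp add: Aut_def)

lemma ainv_eq:
  assumes "T \<in> borel_aut M"
  shows "ainv M T = restrict (inv_into (space M) T) (space M)"
  using assms group.m_inv_consistent[OF group_BijGroup borel_aut_subgroup assms]
  by (simp add: Aut_def inv_BijGroup_eq borel_aut_def)

lemma mult_Aut:
  assumes "S \<in> borel_aut M" "T \<in> borel_aut M"
  shows "S \<otimes>\<^bsub>Aut M\<^esub> T = compose (space M) S T"
  using assms by (simp add: Aut_def BijGroup_def borel_aut_def)

lemma Ctbl_normal: "Ctbl M \<lhd> Aut M"
proof -
  interpret group "Aut M" by (rule group_Aut)
  let ?S = "space M"
  have mem: "T x \<in> ?S" if "T \<in> borel_aut M" "x \<in> ?S" for T x
    using that by (auto simp: borel_aut_def measurable_def)
  have inj: "x = y" if "T \<in> borel_aut M" "x \<in> ?S" "y \<in> ?S" "T x = T y" for T x y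
    using that by (auto simp: borel_aut_def Bij_def bij_betw_def inj_on_def)
  have right: "T (ainv M T x) = x" if "T \<in> borel_aut M" "x \<in> ?S" for T x
    using that by (auto simp: ainv_eq borel_aut_def Bij_def bij_betw_inv_into_right)
  have inv_mem: "ainv M T \<in> borel_aut M" if "T \<in> borel_aut M" for T
    using inv_closed that by (simp add: carrier_Aut)
  show ?thesis
  proof (intro normal_invI subgroupI)
    show "Ctbl M \<subseteq> carrier (Aut M)" by (auto simp: Ctbl_def carrier_Aut)
    have "\<one>\<^bsub>Aut M\<^esub> = (\<lambda>x\<in>?S. x)" by (simp add: Aut_def BijGroup_def)
    then have "\<one>\<^bsub>Aut M\<^esub> \<in> Ctbl M"
      using one_closed by (auto simp: Ctbl_def carrier_Aut)
    then show "Ctbl M \<noteq> {}" by blast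
  next
    fix T assume T: "T \<in> Ctbl M"
    then have Tb: "T \<in> borel_aut M" and c: "countable {x \<in> ?S. T x \<noteq> x}"
      by (auto simp: Ctbl_def)
    have "{x \<in> ?S. ainv M T x \<noteq> x} \<subseteq> {x \<in> ?S. T x \<noteq> x}"
      using right[OF Tb] inj[OF Tb] mem[OF inv_mem[OF Tb]] by fastforce
    then show "ainv M T \<in> Ctbl M"
      using inv_mem[OF Tb] c countable_subset by (auto simp: Ctbl_def)
  next
    fix T U assume a: "T \<in> Ctbl M" "U \<in> Ctbl M"
    then have b: "T \<in> borel_aut M" "U \<in> borel_aut M" by (auto simp: Ctbl_def)
    have "{x \<in> ?S. compose ?S T U x \<noteq> x} \<subseteq> {x \<in> ?S. T x \<noteq> x} \<union> {x \<in> ?S. U x \<noteq> x}"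
      by (auto simp: compose_def)
    moreover have "countable ({x \<in> ?S. T x \<noteq> x} \<union> {x \<in> ?S. U x \<noteq> x})"
      using a by (auto simp: Ctbl_def)
    ultimately have "countable {x \<in> ?S. compose ?S T U x \<noteq> x}"
      by (rule countable_subset)
    then show "T \<otimes>\<^bsub>Aut M\<^esub> U \<in> Ctbl M"
      using m_closed[of T U] b by (simp add: Ctbl_def carrier_Aut mult_Aut)
  next
    fix T U assume T: "T \<in> carrier (Aut M)" and U: "U \<in> Ctbl M"
    then have b: "T \<in> borel_aut M" "U \<in> borel_aut M" and c: "countable {x \<in> ?S. U x \<noteq> x}"
      by (auto simp: Ctbl_def carrier_Aut)
    let ?V = "T \<otimes>\<^bsub>Aut M\<^esub> U \<otimes>\<^bsub>Aut M\<^esub> ainv M T"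
    have V: "?V \<in> borel_aut M"
      using m_closed inv_closed b by (simp add: carrier_Aut[symmetric])
    have "?V = compose ?S (compose ?S T U) (ainv M T)"
      using m_closed[of T U] b inv_mem[OF b(1)] by (simp add: mult_Aut carrier_Aut)
    then have "?V x = T (U (ainv M T x))" if "x \<in> ?S" for x
      using that mem[OF inv_mem[OF b(1)]] by (simp add: compose_def)
    then have "{x \<in> ?S. ?V x \<noteq> x} \<subseteq> T ` {x \<in> ?S. U x \<noteq> x}"
      using right[OF b(1)] mem[OF inv_mem[OF b(1)]] by (force simp: image_iff)
    then have "countable {x \<in> ?S. ?V x \<noteq> x}"
      using c by (meson countable_image countable_subset)
    then show "?V \<in> Ctbl M" using V by (simp add: Ctbl_def)
  qed
qed

lemma group_Aut_hat: "group (Aut_hat M)"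
  unfolding Aut_hat_def by (rule normal.factorgroup_is_group[OF Ctbl_normal])

lemma carrier_Aut_hat: "carrier (Aut_hat M) = hat_class M ` borel_aut M"
  by (simp add: Aut_hat_def FactGroup_def RCOSETS_def hat_class_def carrier_Aut UNION_singleton_eq_range)

lemma istopology_quotient:
  "istopology (\<lambda>U. U \<subseteq> f ` topspace X \<and> openin X {x \<in> topspace X. f x \<in> U})"
proof -
  let ?P = "\<lambda>U. {x \<in> topspace X. f x \<in> U}"
  have int: "?P (S \<inter> T) = ?P S \<inter> ?P T" for S T by blast
  have un: "?P (\<Union>\<K>) = (\<Union>K\<in>\<K>. ?P K)" for \<K> by blast
  show ?thesis
    unfolding istopology_def int un by (blast intro: openin_Int openin_Union)
qed

lemma openin_quotient_topology:
  "openin (quotient_topology X f) U \<longleftrightarrow>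
     U \<subseteq> f ` topspace X \<and> openin X {x \<in> topspace X. f x \<in> U}"
  unfolding quotient_topology_def by (rule fun_cong[OF topology_inverse'[OF istopology_quotient]])

lemma quotient_map_quotient_topology: "quotient_map X (quotient_topology X f) f"
proof -
  have "{x \<in> topspace X. f x \<in> f ` topspace X} = topspace X" by blast
  then have "openin (quotient_topology X f) (f ` topspace X)"
    by (simp add: openin_quotient_topology)
  then have "topspace (quotient_topology X f) = f ` topspace X"
    by (meson openin_quotient_topology openin_subset openin_topspace subset_antisym)
  then show ?thesis
    by (auto simp: quotient_map_def openin_quotient_topology)
qed

lemma topspace_tau: "topspace (tau M) = borel_aut M"
proof -
  let ?\<B> = "{tau_nbhd M T \<M> \<epsilon> | T \<M> \<epsilon>.
      T \<in> borel_aut M \<and> finite \<M> \<and> \<M> \<subseteq> prob_measures M \<and> \<epsilon> > 0}"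
  have "\<Union>?\<B> \<subseteq> borel_aut M" by (auto simp: tau_nbhd_def)
  moreover have "T \<in> \<Union>?\<B>" if "T \<in> borel_aut M" for T
  proof
    show "T \<in> tau_nbhd M T {} 1" using that by (simp add: tau_nbhd_def)
    have "finite ({} :: 'a measure set)" "{} \<subseteq> prob_measures M" "(1::real) > 0" by simp_all
    then show "tau_nbhd M T {} 1 \<in> ?\<B>" using that by blast
  qed
  ultimately have "\<Union>?\<B> = borel_aut M" by (meson subsetI subset_antisym)
  then show ?thesis
    unfolding tau_def topology_generated_by_topspace .
qed

lemma topspace_tau_hat: "topspace (tau_hat M) = carrier (Aut_hat M)"
  using quotient_map_quotient_topology[of "tau M" "hat_class M"]
  by (simp add: tau_hat_def quotient_map_def topspace_tau carrier_Aut_hat)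

end

theory Submission
  imports Defs
begin

text \<open>
  (1) In each of the six topologies every automorphism \<open>S\<close> has, for every point \<open>x\<close>, a neighbourhood
  on which \<open>R x = S x\<close>: use the point mass at \<open>x\<close> for \<open>\<tau>\<close>, the set \<open>{x}\<close> or its indicator for \<open>p\<close>
  and its variant, and these together with the point mass at \<open>S x\<close> for the others. Hence a condition
  on the values of automorphisms at single points defines a closed set.

  (2) The preimage of the full group in \<open>Aut(X, B)\<close> consists of the \<open>\<gamma>\<close> that leave the orbits of \<open>T\<close>
  only on a countable set. If the set \<open>A\<close> of points where \<open>S\<close> leaves the orbits is uncountable, then
  \<open>A\<close>, being Borel, carries a diffuse probability measure \<open>\<mu>\<close>. If \<open>\<mu>(E(S, R)) < 1\<close>, then \<open>R\<close> agrees
  with \<open>S\<close> on a part of \<open>A\<close> of positive measure, so \<open>R\<close> leaves the orbits on an uncountable set too.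
  The measure comes from the perfect set theorem for Borel sets: every Borel set has a convergent
  Suslin scheme, in which an uncountable set can be split repeatedly into disjoint uncountable parts,
  and this gives a continuous injection of the Cantor space.
\<close>

subsection \<open>Convergent Suslin schemes\<close>

text \<open>Such a scheme represents \<open>B\<close> as a countably branching tree of sets all of whose nonempty
  branches shrink to a point of \<open>B\<close>; it plays the role of a continuous surjection from a closed
  subset of the Baire space onto \<open>B\<close>.\<close>

definition suslin_scheme :: "'a topology \<Rightarrow> 'a set \<Rightarrow> (nat list \<Rightarrow> 'a set) \<Rightarrow> bool" where
  "suslin_scheme X B A \<longleftrightarrow> A [] = B \<and> (\<forall>s. A s = (\<Union>k. A (s @ [k]))) \<and>
     (\<forall>\<sigma>. (\<forall>n. A (map \<sigma> [0..<n]) \<noteq> {}) \<longrightarrow>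
        (\<exists>l. (\<forall>n. l \<in> A (map \<sigma> [0..<n])) \<and>
             (\<forall>U. openin X U \<longrightarrow> l \<in> U \<longrightarrow> (\<exists>n. A (map \<sigma> [0..<n]) \<subseteq> U))))"

lemma suslin_schemeI:
  assumes "A [] = B" "\<And>s. A s = (\<Union>k. A (s @ [k]))"
    and "\<And>\<sigma>. (\<And>n. A (map \<sigma> [0..<n]) \<noteq> {}) \<Longrightarrow>
        \<exists>l. (\<forall>n. l \<in> A (map \<sigma> [0..<n])) \<and>
             (\<forall>U. openin X U \<longrightarrow> l \<in> U \<longrightarrow> (\<exists>n. A (map \<sigma> [0..<n]) \<subseteq> U))"
  shows "suslin_scheme X B A"
  unfolding suslin_scheme_def
proof (intro conjI allI impI)
  show "A s = (\<Union>k. A (s @ [k]))" for s by (rule assms(2))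
qed (use assms(1,3) in blast)+

lemma suslin_scheme_Nil: "suslin_scheme X B A \<Longrightarrow> A [] = B"
  unfolding suslin_scheme_def by (rule conjunct1)

lemma suslin_scheme_children: "suslin_scheme X B A \<Longrightarrow> A s = (\<Union>k. A (s @ [k]))"
  unfolding suslin_scheme_def by (elim conjE) (erule spec)

lemma suslin_scheme_limit:
  assumes "suslin_scheme X B A" "\<And>n. A (map \<sigma> [0..<n]) \<noteq> {}"
  obtains l where "\<And>n. l \<in> A (map \<sigma> [0..<n])"
    "\<And>U. openin X U \<Longrightarrow> l \<in> U \<Longrightarrow> \<exists>n. A (map \<sigma> [0..<n]) \<subseteq> U"
  using assms unfolding suslin_scheme_def by metis

lemma suslin_scheme_antimono:
  assumes "suslin_scheme X B A" "m \<le> n"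
  shows "A (map \<sigma> [0..<n]) \<subseteq> A (map \<sigma> [0..<m])"
  using assms(2)
proof (induction n rule: dec_induct)
  case (step n)
  have "A (map \<sigma> [0..<n] @ [\<sigma> n]) \<subseteq> A (map \<sigma> [0..<n])"
    using suslin_scheme_children[OF assms(1), of "map \<sigma> [0..<n]"] by blast
  then show ?case using step by simp
qed simp

text \<open>The first entry of a node selects one of the given schemes and the remaining entries are
  followed in that scheme. So a nonempty branch of the new scheme is a branch of a single old one
  with the root put in front.\<close>

lemma suslin_scheme_UN:
  fixes B :: "nat \<Rightarrow> 'a set"
  assumes "\<And>i. suslin_scheme X (B i) (A i)"
  shows "suslin_scheme X (\<Union>i. B i) (case_list (\<Union>i. B i) A)"
proof (rule suslin_schemeI)
  fix s
  show "case_list (\<Union>i. B i) A s = (\<Union>k. case_list (\<Union>i. B i) A (s @ [k]))"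
  proof (cases s)
    case Nil
    then show ?thesis using suslin_scheme_Nil[OF assms] by simp
  next
    case (Cons i t)
    then show ?thesis using suslin_scheme_children[OF assms, of i t] by simp
  qed
next
  fix \<sigma> assume ne: "\<And>n. case_list (\<Union>i. B i) A (map \<sigma> [0..<n]) \<noteq> {}"
  \<comment> \<open>Dropping the first index turns a branch at level \<open>Suc n\<close> into the
    branch of the scheme \<open>A (\<sigma> 0)\<close> at level \<open>n\<close> along the shifted
    sequence.\<close>
  have eq: "case_list (\<Union>i. B i) A (map \<sigma> [0..<Suc n]) = A (\<sigma> 0) (map (\<lambda>i. \<sigma> (Suc i)) [0..<n])" for n
    by (simp only: map_upt_Suc list.case)
  obtain l where l: "\<And>n. l \<in> A (\<sigma> 0) (map (\<lambda>i. \<sigma> (Suc i)) [0..<n])"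
    and U: "\<And>U. openin X U \<Longrightarrow> l \<in> U \<Longrightarrow> \<exists>n. A (\<sigma> 0) (map (\<lambda>i. \<sigma> (Suc i)) [0..<n]) \<subseteq> U"
    using suslin_scheme_limit[OF assms[of "\<sigma> 0"], of "\<lambda>i. \<sigma> (Suc i)"] ne eq by metis
  have "l \<in> B (\<sigma> 0)" using l[of 0] suslin_scheme_Nil[OF assms] by simp
  then have "l \<in> case_list (\<Union>i. B i) A (map \<sigma> [0..<n])" for n
    using l eq by (cases n) (auto simp del: upt_Suc)
  then show "\<exists>l. (\<forall>n. l \<in> case_list (\<Union>i. B i) A (map \<sigma> [0..<n])) \<and>
      (\<forall>U. openin X U \<longrightarrow> l \<in> U \<longrightarrow> (\<exists>n. case_list (\<Union>i. B i) A (map \<sigma> [0..<n]) \<subseteq> U))"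
    using U eq by metis
qed simp

text \<open>The index at level \<open>n\<close> codes the next step in each of the first \<open>n + 1\<close> schemes, so that the
  \<open>i\<close>-th scheme joins in at level \<open>i\<close>.\<close>

lemma suslin_scheme_INT:
  fixes B :: "nat \<Rightarrow> 'a set"
  assumes X: "Hausdorff_space X" "\<And>i. B i \<subseteq> topspace X"
    and scheme: "\<And>i. suslin_scheme X (B i) (A i)"
  defines "C \<equiv> \<lambda>s. (\<Inter>i. B i) \<inter>
      (\<Inter>i<length s. A i (map (\<lambda>k. list_decode k ! i) (drop i s)))"
  shows "suslin_scheme X (\<Inter>i. B i) C"
proof (rule suslin_schemeI)
  show "C [] = (\<Inter>i. B i)" by (simp add: C_def)
next
  fix s
  show "C s = (\<Union>k. C (s @ [k]))"
  proof
    show "(\<Union>k. C (s @ [k])) \<subseteq> C s"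
    proof (intro UN_least subsetI)
      fix x k assume x: "x \<in> C (s @ [k])"
      have "x \<in> A i (map (\<lambda>k. list_decode k ! i) (drop i s))" if "i < length s" for i
      proof -
        have "C (s @ [k]) \<subseteq> A i (map (\<lambda>k. list_decode k ! i) (drop i (s @ [k])))"
          unfolding C_def using that by (intro Int_lower2[THEN subset_trans] INT_lower) simp
        then have "x \<in> A i (map (\<lambda>k. list_decode k ! i) (drop i (s @ [k])))"
          using x by blast
        then have "x \<in> A i (map (\<lambda>k. list_decode k ! i) (drop i s) @ [list_decode k ! i])"
          using that by simp
        then show ?thesis
          using suslin_scheme_children[OF scheme, of i "map (\<lambda>k. list_decode k ! i) (drop i s)"] by blast
      qed
      then show "x \<in> C s" using x by (simp add: C_def)
    qed
    show "C s \<subseteq> (\<Union>k. C (s @ [k]))"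
    proof
      fix x assume x: "x \<in> C s"
      \<comment> \<open>For \<open>i = length s\<close> the \<open>i\<close>-th scheme is still at
        its root \<open>B i\<close>. The definition of \<open>C\<close> does not list this root
        among the nodes of the schemes, but \<open>C s\<close> lies in all the
        \<open>B i\<close>.\<close>
      have "\<exists>k. x \<in> A i (map (\<lambda>k. list_decode k ! i) (drop i s) @ [k])" if "i \<le> length s" for i
      proof -
        have "x \<in> A i (map (\<lambda>k. list_decode k ! i) (drop i s))"
          using x that suslin_scheme_Nil[OF scheme, of i] by (cases "i = length s") (auto simp: C_def)
        then show ?thesis using suslin_scheme_children[OF scheme] by blast
      qed
      then obtain k where k: "\<And>i. i \<le> length s \<Longrightarrow>
          x \<in> A i (map (\<lambda>k. list_decode k ! i) (drop i s) @ [k i])" by metis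
      \<comment> \<open>A single index codes the steps to be taken at once in the schemes
        \<open>0\<close> up to \<open>length s\<close>.\<close>
      define c where "c = list_encode (map k [0..<Suc (length s)])"
      have "list_decode c ! i = k i" if "i \<le> length s" for i
        using that by (simp add: c_def del: upt_Suc)
      then have "x \<in> A i (map (\<lambda>k. list_decode k ! i) (drop i (s @ [c])))" if "i \<le> length s" for i
        using k[OF that] that by simp
      moreover have "x \<in> (\<Inter>i. B i)" using x by (simp add: C_def)
      ultimately have "x \<in> C (s @ [c])"
        unfolding C_def by (simp add: less_Suc_eq_le)
      then show "x \<in> (\<Union>k. C (s @ [k]))" by blast
    qed
  qed
next
  fix \<sigma> assume ne: "\<And>n. C (map \<sigma> [0..<n]) \<noteq> {}"
  \<comment> \<open>\<open>\<rho> i\<close> is the sequence that the branch \<open>\<sigma>\<close>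
    induces in the \<open>i\<close>-th scheme, which starts at level \<open>i\<close>.\<close>
  define \<rho> where "\<rho> i m = list_decode (\<sigma> (i + m)) ! i" for i m
  have \<rho>: "map (\<lambda>k. list_decode k ! i) (drop i (map \<sigma> [0..<n])) = map (\<rho> i) [0..<n - i]" for i n
    by (rule nth_equalityI) (auto simp: \<rho>_def)
  have sub: "C (map \<sigma> [0..<i + n]) \<subseteq> A i (map (\<rho> i) [0..<n])" for i n
  proof (cases n)
    case 0
    then show ?thesis using suslin_scheme_Nil[OF scheme] by (auto simp: C_def)
  next
    case (Suc m)
    then have "C (map \<sigma> [0..<i + n]) \<subseteq> A i (map (\<lambda>k. list_decode k ! i) (drop i (map \<sigma> [0..<i + n])))"
      unfolding C_def by (intro Int_lower2[THEN subset_trans] INT_lower) simp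
    then show ?thesis unfolding \<rho> by simp
  qed
  have "\<exists>l. (\<forall>n. l \<in> A i (map (\<rho> i) [0..<n])) \<and>
      (\<forall>U. openin X U \<longrightarrow> l \<in> U \<longrightarrow> (\<exists>n. A i (map (\<rho> i) [0..<n]) \<subseteq> U))" for i
    using suslin_scheme_limit[OF scheme, of i "\<rho> i"] ne sub by (metis subset_empty)
  then obtain l where l: "\<And>i n. l i \<in> A i (map (\<rho> i) [0..<n])"
    and U: "\<And>i U. openin X U \<Longrightarrow> l i \<in> U \<Longrightarrow> \<exists>n. A i (map (\<rho> i) [0..<n]) \<subseteq> U"
    by metis
  have lB: "l i \<in> B i" for i
    using l[of i 0] suslin_scheme_Nil[OF scheme] by simp
  \<comment> \<open>The branches of the single schemes have a common limit: disjoint neighbourhoods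
    of two distinct limits would each contain the sets \<open>C\<close> from some level on, although
    these are nonempty.\<close>
  have l0: "l i = l 0" for i
  proof (rule ccontr)
    assume "l i \<noteq> l 0"
    then obtain U V where UV: "openin X U" "openin X V" "l i \<in> U" "l 0 \<in> V" "disjnt U V"
      using X lB unfolding Hausdorff_space_def by (metis subsetD)
    obtain m n where "A i (map (\<rho> i) [0..<m]) \<subseteq> U" "A 0 (map (\<rho> 0) [0..<n]) \<subseteq> V"
      using U UV by meson
    moreover have "C (map \<sigma> [0..<i + (m + n)]) \<subseteq> A i (map (\<rho> i) [0..<m])"
      using sub[of i "m + n"] suslin_scheme_antimono[OF scheme, of m "m + n" i "\<rho> i"] by (auto simp del: upt_Suc)
    moreover have "C (map \<sigma> [0..<i + (m + n)]) \<subseteq> A 0 (map (\<rho> 0) [0..<n])"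
      using sub[of 0 "i + (m + n)"] suslin_scheme_antimono[OF scheme, of n "i + (m + n)" 0 "\<rho> 0"] by auto
    ultimately show False using ne[of "i + (m + n)"] UV(5) unfolding disjnt_def by blast
  qed
  have "l 0 \<in> C (map \<sigma> [0..<n])" for n
    using l lB l0 unfolding C_def \<rho> by (metis (no_types, lifting) INT_I IntI)
  moreover have "\<exists>n. C (map \<sigma> [0..<n]) \<subseteq> U" if "openin X U" "l 0 \<in> U" for U
    using U[OF that] sub[of 0] by (metis add_0 subset_trans)
  ultimately show "\<exists>l. (\<forall>n. l \<in> C (map \<sigma> [0..<n])) \<and>
      (\<forall>U. openin X U \<longrightarrow> l \<in> U \<longrightarrow> (\<exists>n. C (map \<sigma> [0..<n]) \<subseteq> U))"
    by blast
qed

text \<open>At level \<open>n\<close> the set is covered by the closed balls of radius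
  \<open>1 / 2 ^ n\<close> about the points of a dense sequence. Along a branch the nodes are nested
  closed sets inside ever smaller balls, so that completeness yields a common point.\<close>

lemma (in Metric_space) suslin_scheme_closedin:
  assumes "mcomplete" "countable D" "D \<subseteq> M" "Abstract_Topology.closure_of mtopology D = M" "closedin mtopology F"
  shows "\<exists>A. suslin_scheme mtopology F A"
proof (cases "F = {}")
  \<comment> \<open>An empty \<open>F\<close> is treated apart, since the enumeration of
    \<open>D\<close> below requires \<open>D\<close> to be nonempty.\<close>
  case True
  then have "suslin_scheme mtopology F (\<lambda>_. {})" by (simp add: suslin_scheme_def)
  then show ?thesis by blast
next
  case False
  have FM: "F \<subseteq> M" using assms(5) closedin_subset by fastforce
  then have "D \<noteq> {}" using False assms(4) by auto
  define e where "e = from_nat_into D"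
  have e: "range e = D" unfolding e_def using assms(2) \<open>D \<noteq> {}\<close> by (rule range_from_nat_into[rotated])
  have dense: "\<exists>k. x \<in> mcball (e k) r" if x: "x \<in> M" "r > 0" for x r
  proof -
    have "x \<in> Abstract_Topology.closure_of mtopology D" using assms(4) x by blast
    then obtain y where "y \<in> D" "y \<in> mball x r"
      using x(2) unfolding metric_closure_of by auto
    then show ?thesis using e x by (metis commute in_mball in_mcball less_imp_le rangeE)
  qed
  define A where "A s = F \<inter> (\<Inter>j<length s. mcball (e (s ! j)) (1 / 2 ^ j))" for s
  have A_snoc: "A (s @ [k]) = A s \<inter> mcball (e k) (1 / 2 ^ length s)" for s k
    by (auto simp: A_def nth_append lessThan_Suc split: if_splits)
  have closed: "closedin mtopology (A s)" for s
  proof (induction s rule: rev_induct)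
    case Nil
    then show ?case using assms(5) by (simp add: A_def)
  next
    case (snoc k s)
    then show ?case unfolding A_snoc by (intro closedin_Int closedin_mcball)
  qed
  have "suslin_scheme mtopology F A"
  proof (rule suslin_schemeI)
    show "A [] = F" by (simp add: A_def)
    show "A s = (\<Union>k. A (s @ [k]))" for s
    proof -
      have "\<exists>k. x \<in> mcball (e k) (1 / 2 ^ length s)" if "x \<in> A s" for x
        using dense[of x "1 / 2 ^ length s"] that FM by (auto simp: A_def)
      then show ?thesis unfolding A_snoc by blast
    qed
    fix \<sigma> :: "nat \<Rightarrow> nat" assume ne: "\<And>n. A (map \<sigma> [0..<n]) \<noteq> {}"
    \<comment> \<open>The ball of radius \<open>1 / 2 ^ n\<close> first enters at level
      \<open>Suc n\<close>, because the root is not cut by any ball.\<close>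
    have ball: "A (map \<sigma> [0..<Suc n]) \<subseteq> mcball (e (\<sigma> n)) (1 / 2 ^ n)" for n
      by (simp add: A_snoc)
    have small: "\<exists>n. (1::real) / 2 ^ n < r" if "r > 0" for r
      using real_arch_pow_inv[OF that, of "1/2"] by (auto simp: power_divide)
    have "decseq (\<lambda>n. A (map \<sigma> [0..<n]))"
      by (intro decseq_SucI) (simp add: A_snoc)
    moreover have "\<exists>n a. A (map \<sigma> [0..<n]) \<subseteq> mcball a r" if r: "r > 0" for r
    proof -
      obtain n where "(1::real) / 2 ^ n \<le> r" using small[OF r] less_imp_le by blast
      then have "A (map \<sigma> [0..<Suc n]) \<subseteq> mcball (e (\<sigma> n)) r"
        using ball[of n] mcball_subset_concentric[of "1 / 2 ^ n" r] by blast
      then show ?thesis by blast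
    qed
    ultimately have "(\<Inter>n. A (map \<sigma> [0..<n])) \<noteq> {}"
      using assms(1)[unfolded mcomplete_nest, rule_format, of "\<lambda>n. A (map \<sigma> [0..<n])"] closed ne
      by simp
    then obtain l where l: "\<And>n. l \<in> A (map \<sigma> [0..<n])" by blast
    have "\<exists>n. A (map \<sigma> [0..<n]) \<subseteq> U" if U: "openin mtopology U" "l \<in> U" for U
    proof -
      obtain r where r: "r > 0" "mball l r \<subseteq> U"
        using U unfolding openin_mtopology by blast
      \<comment> \<open>Two points of a closed ball of radius below \<open>r / 2\<close> are less
        than \<open>r\<close> apart.\<close>
      obtain n where n: "(1::real) / 2 ^ n < r / 2" using small[of "r / 2"] r by auto
      have "d l x < r" "x \<in> M" if "x \<in> A (map \<sigma> [0..<Suc n])" for x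
      proof -
        have *: "x \<in> mcball (e (\<sigma> n)) (1 / 2 ^ n)" "l \<in> mcball (e (\<sigma> n)) (1 / 2 ^ n)"
          using ball that l by blast+
        then show "x \<in> M" by simp
        show "d l x < r" using * triangle[of l "e (\<sigma> n)" x] n by (simp add: commute)
      qed
      moreover have "l \<in> M" using l[of 0] FM by (auto simp: A_def)
      ultimately have "A (map \<sigma> [0..<Suc n]) \<subseteq> mball l r"
        by (meson in_mball subsetI)
      then show ?thesis using r by blast
    qed
    then show "\<exists>l. (\<forall>n. l \<in> A (map \<sigma> [0..<n])) \<and>
        (\<forall>U. openin mtopology U \<longrightarrow> l \<in> U \<longrightarrow> (\<exists>n. A (map \<sigma> [0..<n]) \<subseteq> U))"
      using l by blast
  qed
  then show ?thesis by blast
qed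

text \<open>A scheme for a set does not directly give one for its complement, so the induction over
  the Borel sets treats both together. Open sets are countable unions of closed ones, and the
  complement of a countable union is a countable intersection.\<close>

lemma suslin_scheme_sigma_sets:
  assumes "completely_metrizable_space X" "countable D" "D \<subseteq> topspace X"
    "Abstract_Topology.closure_of X D = topspace X" "B \<in> sigma_sets (topspace X) {U. openin X U}"
  shows "\<exists>A. suslin_scheme X B A"
proof -
  obtain S d where S: "Metric_space S d" "Metric_space.mcomplete S d" "X = Metric_space.mtopology S d"
    using assms(1) unfolding completely_metrizable_space_def by blast
  interpret Metric_space S d by (rule S(1))
  have [simp]: "topspace X = S" by (simp add: S(3))
  have closed: "\<exists>A. suslin_scheme X F A" if "closedin X F" for F
    using suslin_scheme_closedin[of D F] that assms S by simp
  have UN: "\<exists>A. suslin_scheme X (\<Union>i. C i) A" if "\<And>i. \<exists>A. suslin_scheme X (C i) A" for C :: "nat \<Rightarrow> 'a set"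
    using that suslin_scheme_UN by metis
  have INT: "\<exists>A. suslin_scheme X (\<Inter>i. C i) A"
    if "\<And>i. \<exists>A. suslin_scheme X (C i) A" "\<And>i. C i \<subseteq> S" for C :: "nat \<Rightarrow> 'a set"
    using suslin_scheme_INT[of X C] that Hausdorff_space_mtopology S(3) \<open>topspace X = S\<close> by metis
  have "(\<exists>A. suslin_scheme X B A) \<and> (\<exists>A. suslin_scheme X (S - B) A)"
    using assms(5) unfolding \<open>topspace X = S\<close>
  proof (induction rule: sigma_sets.induct)
    case (Basic U)
    then have "fsigma_in X U"
      using open_imp_fsigma_in metrizable_space_mtopology S(3) by blast
    then obtain C where "\<And>n::nat. closedin X (C n)" "U = \<Union> (range C)"
      unfolding fsigma_in_ascending by metis
    then have "\<exists>A. suslin_scheme X U A" using UN closed by metis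
    moreover have "closedin X (S - U)" using Basic by (simp add: openin_closedin_eq)
    ultimately show ?case using closed by blast
  next
    case Empty
    then show ?case using closed[of "{}"] closed[of S] closedin_topspace[of X] by simp
  next
    case (Compl B)
    have "B \<subseteq> S" using Compl.hyps sigma_sets_into_sp[of "{U. openin X U}" S] openin_subset[of X] by auto
    then have "S - (S - B) = B" by blast
    then show ?case using Compl.IH by simp
  next
    case (Union C)
    have "C i \<subseteq> S" for i
      using Union.hyps[of i] sigma_sets_into_sp[of "{U. openin X U}" S] openin_subset[of X] by auto
    then have "S - (\<Union>i. C i) = (\<Inter>i. S - C i)" by blast
    then show ?case using Union.IH UN[of C] INT[of "\<lambda>i. S - C i"] by auto
  qed
  then show ?thesis by blast
qed

subsection \<open>Perfect subsets\<close>

text \<open>Countability makes it possible to discard all pieces with countable trace at once and to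
  write the inequality of two maps as a countable union. Closedness keeps the limits of branches
  inside the chosen sets.\<close>

definition separating_pairs :: "'a topology \<Rightarrow> ('a set \<times> 'a set) set \<Rightarrow> bool" where
  "separating_pairs X P \<longleftrightarrow> countable P \<and>
     (\<forall>U V. (U, V) \<in> P \<longrightarrow> closedin X U \<and> closedin X V \<and> disjnt U V) \<and>
     (\<forall>x\<in>topspace X. \<forall>y\<in>topspace X. x \<noteq> y \<longrightarrow> (\<exists>(U, V)\<in>P. x \<in> U \<and> y \<in> V))"

lemma separating_pairsD:
  assumes "separating_pairs X P"
  shows "countable P" "(U, V) \<in> P \<Longrightarrow> closedin X U" "(U, V) \<in> P \<Longrightarrow> closedin X V"
    "(U, V) \<in> P \<Longrightarrow> disjnt U V"
  using assms by (simp_all add: separating_pairs_def)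

lemma separating_pairsE:
  assumes "separating_pairs X P" "x \<in> topspace X" "y \<in> topspace X" "x \<noteq> y"
  obtains U V where "(U, V) \<in> P" "x \<in> U" "y \<in> V"
  using assms unfolding separating_pairs_def by blast

text \<open>The pairs are the disjoint ones among the pairs of closed balls with rational radii
  about points of the dense set.\<close>

lemma (in Metric_space) ex_separating_pairs:
  assumes "countable D" "D \<subseteq> M" "Abstract_Topology.closure_of mtopology D = M"
  shows "\<exists>P. separating_pairs mtopology P"
proof
  let ?f = "\<lambda>(a, b, r::rat). (mcball a (of_rat r), mcball b (of_rat r))"
  let ?P = "{(U, V) \<in> ?f ` (D \<times> D \<times> UNIV). disjnt U V}"
  have "countable (?f ` (D \<times> D \<times> UNIV))"
    using assms(1) by (intro countable_image countable_SIGMA) auto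
  then have cnt: "countable ?P" by (rule countable_subset[rotated]) blast
  have closed: "closedin mtopology U \<and> closedin mtopology V \<and> disjnt U V" if "(U, V) \<in> ?P" for U V
    using that by auto
  have sep: "\<exists>(U, V)\<in>?P. x \<in> U \<and> y \<in> V" if xy: "x \<in> M" "y \<in> M" "x \<noteq> y" for x y
  proof -
    \<comment> \<open>With a radius \<open>r\<close> below a quarter of the distance, a common point
      of the balls about \<open>a\<close> and \<open>b\<close> would give a path from
      \<open>x\<close> to \<open>y\<close> over \<open>a\<close>, this point and \<open>b\<close> of
      length at most \<open>4 * r\<close>, less than \<open>d x y\<close>.\<close>
    have "d x y / 4 > 0" using xy by simp
    then obtain r where "0 < real_of_rat r" and r2: "real_of_rat r < d x y / 4"
      using of_rat_dense by blast
    then have r: "real_of_rat r > 0" by simp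
    have near: "\<exists>a\<in>D. z \<in> mcball a (of_rat r)" if z: "z \<in> M" for z
    proof -
      have "z \<in> Abstract_Topology.closure_of mtopology D" using assms(3) z by blast
      then obtain a where "a \<in> D" "a \<in> mball z (of_rat r)"
        using r unfolding metric_closure_of by blast
      then show ?thesis by (metis commute in_mball in_mcball less_imp_le)
    qed
    obtain a where a: "a \<in> D" "x \<in> mcball a (of_rat r)" using near[OF xy(1)] by blast
    obtain b where b: "b \<in> D" "y \<in> mcball b (of_rat r)" using near[OF xy(2)] by blast
    have "disjnt (mcball a (of_rat r)) (mcball b (of_rat r))"
      unfolding disjnt_iff
    proof (intro allI notI, elim conjE)
      fix z assume z: "z \<in> mcball a (of_rat r)" "z \<in> mcball b (of_rat r)"
      have "d x y \<le> d x a + d a z + d z b + d b y"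
        using a b z triangle[of x a y] triangle[of a z y] triangle[of z b y] by simp
      then show False using a b z r2 by (simp add: commute)
    qed
    moreover have "(mcball a (of_rat r), mcball b (of_rat r)) \<in> ?f ` (D \<times> D \<times> UNIV)"
      using a b by (intro image_eqI[of _ _ "(a, b, r)"]) simp_all
    ultimately have "(mcball a (of_rat r), mcball b (of_rat r)) \<in> ?P" by blast
    then show ?thesis using a(2) b(2) by blast
  qed
  show "separating_pairs mtopology ?P"
    unfolding separating_pairs_def topspace_mtopology
    by (intro conjI allI ballI impI) (rule cnt sep closed[THEN conjunct1] closed[THEN conjunct2, THEN conjunct1]
        closed[THEN conjunct2, THEN conjunct2]; assumption)+
qed

text \<open>Outside a countable set, every point of \<open>A s \<inter> E\<close> meets only members
  of pairs with uncountable trace. A pair separating two such points cuts \<open>E\<close> into two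
  disjoint closed parts, and each trace stays uncountable on some child of \<open>s\<close>.\<close>

lemma suslin_scheme_split:
  assumes scheme: "suslin_scheme X B A"
    and P: "separating_pairs X P"
    and E: "closedin X E" "uncountable (A s \<inter> E)"
  obtains k E' l F' where "closedin X E'" "E' \<subseteq> E" "uncountable (A (s @ [k]) \<inter> E')"
    "closedin X F'" "F' \<subseteq> E" "uncountable (A (s @ [l]) \<inter> F')" "disjnt E' F'"
proof -
  \<comment> \<open>\<open>N\<close> collects all countable traces of members of pairs; it is
    countable because there are countably many pairs.\<close>
  define N where "N = (\<Union>(U, V)\<in>P. (if countable (A s \<inter> E \<inter> U) then A s \<inter> E \<inter> U else {}) \<union>
      (if countable (A s \<inter> E \<inter> V) then A s \<inter> E \<inter> V else {}))"
  have "countable N" unfolding N_def using separating_pairsD(1)[OF P] by (intro countable_UN) auto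
  then have unc: "uncountable (A s \<inter> E - N)" using E(2) by (simp add: uncountable_minus_countable)
  then obtain x where x: "x \<in> A s \<inter> E - N" by (metis countable_empty ex_in_conv)
  have "uncountable (A s \<inter> E - N - {x})" using unc by (simp add: uncountable_minus_countable)
  then obtain y where y: "y \<in> A s \<inter> E - N - {x}" by (metis countable_empty ex_in_conv)
  have EX: "E \<subseteq> topspace X" using E(1) closedin_subset by blast
  then obtain U V where UV: "(U, V) \<in> P" "x \<in> U" "y \<in> V"
    using separating_pairsE[OF P, of x y] x y by blast
  have unc2: "uncountable (A s \<inter> E \<inter> U)" "uncountable (A s \<inter> E \<inter> V)"
  proof -
    show "uncountable (A s \<inter> E \<inter> U)"
    proof
      assume "countable (A s \<inter> E \<inter> U)"
      then have "x \<in> N" using UV x unfolding N_def by (intro UN_I[of "(U, V)"]) auto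
      then show False using x by blast
    qed
    show "uncountable (A s \<inter> E \<inter> V)"
    proof
      assume "countable (A s \<inter> E \<inter> V)"
      then have "y \<in> N" using UV y unfolding N_def by (intro UN_I[of "(U, V)"]) auto
      then show False using y by blast
    qed
  qed
  have child: "\<exists>k. uncountable (A (s @ [k]) \<inter> (E \<inter> W))" if W: "uncountable (A s \<inter> E \<inter> W)" for W
  proof (rule ccontr)
    assume "\<not> ?thesis"
    then have "countable (\<Union>k. A (s @ [k]) \<inter> (E \<inter> W))" by (intro countable_UN) auto
    moreover have "A s \<inter> E \<inter> W = (\<Union>k. A (s @ [k]) \<inter> (E \<inter> W))"
      using suslin_scheme_children[OF scheme, of s] by blast
    ultimately show False using W by simp
  qed
  obtain k l where "uncountable (A (s @ [k]) \<inter> (E \<inter> U))" "uncountable (A (s @ [l]) \<inter> (E \<inter> V))"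
    using child unc2 by meson
  then show thesis
    using that[of "E \<inter> U" k "E \<inter> V" l] separating_pairsD(2-)[OF P UV(1)] E(1) closedin_Int
    by (metis Int_lower1 disjnt_subset1 disjnt_subset2 inf_le2)
qed

text \<open>The values below are found along a binary tree of pairs of a node of the scheme and a closed
  set such that the two have uncountable intersection; siblings have disjoint closed sets.\<close>

lemma suslin_scheme_Cantor_embedding:
  assumes scheme: "suslin_scheme X B A" and BX: "B \<subseteq> topspace X" and B: "uncountable B"
    and P: "separating_pairs X P"
  obtains \<phi> :: "(nat \<Rightarrow> bool) \<Rightarrow> 'a" where "inj \<phi>" "range \<phi> \<subseteq> B"
    "\<And>U b. openin X U \<Longrightarrow> \<phi> b \<in> U \<Longrightarrow> \<exists>n. \<forall>b'. (\<forall>i<n. b' i = b i) \<longrightarrow> \<phi> b' \<in> U"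
proof -
  define good where "good = {(s, E). closedin X E \<and> uncountable (A s \<inter> E)}"
  \<comment> \<open>A function \<open>st\<close> choosing both children of every good node turns the
    splitting into a recursion along binary sequences.\<close>
  have "\<exists>st. \<forall>q\<in>good. \<forall>c. st q c \<in> good \<and> snd (st q c) \<subseteq> snd q \<and> (\<exists>k. fst (st q c) = fst q @ [k]) \<and>
      disjnt (snd (st q True)) (snd (st q False))"
  proof (intro bchoice ballI)
    fix q assume "q \<in> good"
    then obtain s E where q: "q = (s, E)" "closedin X E" "uncountable (A s \<inter> E)"
      by (auto simp: good_def)
    obtain k E' l F' where *: "closedin X E'" "E' \<subseteq> E" "uncountable (A (s @ [k]) \<inter> E')"
      "closedin X F'" "F' \<subseteq> E" "uncountable (A (s @ [l]) \<inter> F')" "disjnt E' F'"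
      by (rule suslin_scheme_split[OF scheme P q(2,3)])
    show "\<exists>st. \<forall>c. st c \<in> good \<and> snd (st c) \<subseteq> snd q \<and> (\<exists>k. fst (st c) = fst q @ [k]) \<and>
      disjnt (snd (st True)) (snd (st False))"
      using * by (intro exI[of _ "\<lambda>c. if c then (s @ [k], E') else (s @ [l], F')"]) (auto simp: good_def q(1))
  qed
  then obtain st where st: "\<And>q c. q \<in> good \<Longrightarrow> st q c \<in> good" "\<And>q c. q \<in> good \<Longrightarrow> snd (st q c) \<subseteq> snd q"
    "\<And>q c. q \<in> good \<Longrightarrow> \<exists>k. fst (st q c) = fst q @ [k]"
    "\<And>q. q \<in> good \<Longrightarrow> disjnt (snd (st q True)) (snd (st q False))"
    by metis
  define N where "N b = rec_nat ([], topspace X) (\<lambda>n q. st q (b n))" for b :: "nat \<Rightarrow> bool"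
  have N0: "N b 0 = ([], topspace X)" and NSuc: "N b (Suc n) = st (N b n) (b n)" for b n
    by (simp_all add: N_def)
  have AB: "A [] \<inter> topspace X = B" using suslin_scheme_Nil[OF scheme] BX by blast
  have good: "N b n \<in> good" for b n
  proof (induction n)
    case 0
    then show ?case using B AB by (simp add: N0 good_def)
  next
    case (Suc n)
    show ?case unfolding NSuc by (rule st(1)) (rule Suc.IH)
  qed
  have N_cong: "N b n = N b' n" if "\<forall>i<n. b i = b' i" for b b' n
    using that by (induction n) (auto simp: N0 NSuc)
  \<comment> \<open>Each step appends one entry to the node, and \<open>last\<close> reads it off;
    so \<open>\<sigma> b\<close> is the branch of the scheme followed along
    \<open>b\<close>.\<close>
  define \<sigma> where "\<sigma> b n = last (fst (N b (Suc n)))" for b n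
  have fst_N: "fst (N b n) = map (\<sigma> b) [0..<n]" for b n
  proof (induction n)
    case (Suc n)
    have "fst (N b (Suc n)) = fst (N b n) @ [\<sigma> b n]"
      using st(3)[OF good, of b n "b n"] unfolding \<sigma>_def NSuc by auto
    then show ?case using Suc by simp
  qed (simp add: N0)
  define D where "D b n = A (fst (N b n)) \<inter> snd (N b n)" for b n
  have D_ne: "D b n \<noteq> {}" for b n
    using good[of b n] unfolding good_def D_def by (auto simp: countable_empty)
  have snd_mono: "snd (N b n) \<subseteq> snd (N b m)" if "m \<le> n" for b m n
    using that
  proof (induction n rule: dec_induct)
    case (step n)
    have "snd (N b (Suc n)) \<subseteq> snd (N b n)" unfolding NSuc by (rule st(2)[OF good])
    then show ?case using step.IH by (rule subset_trans)
  qed simp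
  have "\<exists>l. (\<forall>n. l \<in> D b n) \<and> (\<forall>U. openin X U \<longrightarrow> l \<in> U \<longrightarrow> (\<exists>n. D b n \<subseteq> U))" for b
  proof -
    have "A (map (\<sigma> b) [0..<n]) \<noteq> {}" for n
      using D_ne[of b n] unfolding D_def fst_N by blast
    then obtain l where l: "\<And>n. l \<in> A (map (\<sigma> b) [0..<n])"
      and U: "\<And>U. openin X U \<Longrightarrow> l \<in> U \<Longrightarrow> \<exists>n. A (map (\<sigma> b) [0..<n]) \<subseteq> U"
      using suslin_scheme_limit[OF scheme] by blast
    \<comment> \<open>Otherwise the complement of the closed set \<open>snd (N b m)\<close> is a
      neighbourhood of \<open>l\<close> and contains the nodes of the branch from some level on. The
      sets \<open>D b\<close> would then be empty at deep levels.\<close>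
    have "l \<in> snd (N b m)" for m
    proof (rule ccontr)
      assume "l \<notin> snd (N b m)"
      moreover have "l \<in> topspace X" using l[of 0] suslin_scheme_Nil[OF scheme] BX by auto
      moreover have "closedin X (snd (N b m))" using good[of b m] by (auto simp: good_def)
      ultimately obtain n where "A (map (\<sigma> b) [0..<n]) \<subseteq> topspace X - snd (N b m)"
        using U[of "topspace X - snd (N b m)"] by auto
      then have "D b (max m n) \<inter> snd (N b m) = {}"
        using suslin_scheme_antimono[OF scheme, of n "max m n" "\<sigma> b"] unfolding D_def fst_N by auto
      moreover have "D b (max m n) \<subseteq> snd (N b m)"
        using snd_mono[of m "max m n" b] unfolding D_def by auto
      ultimately show False using D_ne[of b "max m n"] by blast
    qed
    then have "l \<in> D b n" for n using l unfolding D_def fst_N by blast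
    moreover have "\<exists>n. D b n \<subseteq> V" if V: "openin X V" "l \<in> V" for V
    proof -
      obtain n where "A (map (\<sigma> b) [0..<n]) \<subseteq> V" using U[OF V] by (rule exE)
      then have "D b n \<subseteq> V" unfolding D_def fst_N by blast
      then show ?thesis ..
    qed
    ultimately show ?thesis by meson
  qed
  then have "\<exists>\<phi>. \<forall>b. (\<forall>n. \<phi> b \<in> D b n) \<and> (\<forall>U. openin X U \<longrightarrow> \<phi> b \<in> U \<longrightarrow> (\<exists>n. D b n \<subseteq> U))"
    by (intro choice allI)
  then obtain \<phi> where "\<forall>b. (\<forall>n. \<phi> b \<in> D b n) \<and> (\<forall>U. openin X U \<longrightarrow> \<phi> b \<in> U \<longrightarrow> (\<exists>n. D b n \<subseteq> U))"
    by (rule exE)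
  then have \<phi>: "\<phi> b \<in> D b n" "openin X U \<Longrightarrow> \<phi> b \<in> U \<Longrightarrow> \<exists>n. D b n \<subseteq> U" for b n U
    by simp_all
  show thesis
  proof
    show "inj \<phi>"
    proof (rule injI, rule ccontr)
      fix b b' assume eq: "\<phi> b = \<phi> b'" and "b \<noteq> b'"
      then obtain n where n: "b n \<noteq> b' n" "\<forall>i<n. b i = b' i"
        using exists_least_iff[of "\<lambda>n. b n \<noteq> b' n"] by auto
      have "disjnt (snd (N b (Suc n))) (snd (N b' (Suc n)))"
        using st(4)[OF good[of b n]] n(1) N_cong[OF n(2)] unfolding NSuc
        by (cases "b n"; cases "b' n") (auto simp: disjnt_sym)
      then show False
        using \<phi>(1)[of b "Suc n"] \<phi>(1)[of b' "Suc n"] eq unfolding D_def disjnt_def by auto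
    qed
    show "range \<phi> \<subseteq> B"
      using \<phi>(1)[of _ 0] AB unfolding D_def N0 by auto
    fix U b assume "openin X U" "\<phi> b \<in> U"
    then obtain n where n: "D b n \<subseteq> U" using \<phi>(2) by blast
    \<comment> \<open>A common prefix of length \<open>n\<close> leads to the same node, hence to
      the same set \<open>D b n\<close>.\<close>
    have "\<phi> b' \<in> U" if "\<forall>i<n. b' i = b i" for b'
      using \<phi>(1)[of b' n] n N_cong[OF that] unfolding D_def by auto
    then show "\<exists>n. \<forall>b'. (\<forall>i<n. b' i = b i) \<longrightarrow> \<phi> b' \<in> U" by blast
  qed
qed

subsection \<open>Diffuse measures on standard Borel spaces\<close>

lemma standard_borelE:
  assumes "standard_borel M"
  obtains X P where "topspace X = space M" "sets M = sigma_sets (space M) {U. openin X U}"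
    "\<And>B. B \<in> sets M \<Longrightarrow> \<exists>A. suslin_scheme X B A"
    "separating_pairs X P"
proof -
  obtain X D where X: "topspace X = space M" "completely_metrizable_space X" "countable D"
    "D \<subseteq> topspace X" "Abstract_Topology.closure_of X D = topspace X"
    "sets M = sigma_sets (space M) {U. openin X U}"
    using assms unfolding standard_borel_def by blast
  obtain S d where S: "Metric_space S d" "X = Metric_space.mtopology S d"
    using X(2) unfolding completely_metrizable_space_def by blast
  interpret Metric_space S d by (rule S(1))
  have "topspace X = S" by (simp add: S(2))
  then obtain P where "separating_pairs X P"
    using ex_separating_pairs[of D] X(3-5) S(2) by metis
  moreover have "\<exists>A. suslin_scheme X B A" if "B \<in> sets M" for B
    using suslin_scheme_sigma_sets[OF X(2-5)] that X(1,6) by simp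
  ultimately show thesis using that X(1,6) by blast
qed

text \<open>Two values differ exactly if some separating pair has the first value in its first set
  and the second in its second; there are countably many pairs of closed sets. This amounts to the
  measurability of the diagonal.\<close>

lemma standard_borel_neq_sets:
  assumes "standard_borel M" "f \<in> N \<rightarrow>\<^sub>M M" "g \<in> N \<rightarrow>\<^sub>M M"
  shows "{x \<in> space N. f x \<noteq> g x} \<in> sets N"
proof -
  obtain X P where X: "topspace X = space M" "sets M = sigma_sets (space M) {U. openin X U}"
    and P: "separating_pairs X P"
    by (metis standard_borelE[OF assms(1)])
  have closed: "F \<in> sets M" if "closedin X F" for F
  proof -
    have "topspace X - F \<in> sets M" using that unfolding X(2) by blast
    then have "space M - (topspace X - F) \<in> sets M" by blast
    moreover have "space M - (topspace X - F) = F" using closedin_subset[OF that] X(1) by blast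
    ultimately show ?thesis by simp
  qed
  have sp: "f x \<in> space M" "g x \<in> space M" if "x \<in> space N" for x
    using that assms(2,3) by (auto simp: measurable_space)
  have "{x \<in> space N. f x \<noteq> g x} = (\<Union>(U, V)\<in>P. (f -` U \<inter> space N) \<inter> (g -` V \<inter> space N))"
  proof (intro equalityI subsetI)
    fix x assume x: "x \<in> {x \<in> space N. f x \<noteq> g x}"
    then obtain U V where "(U, V) \<in> P" "f x \<in> U" "g x \<in> V"
      using separating_pairsE[OF P, of "f x" "g x"] sp X(1) by auto
    then show "x \<in> (\<Union>(U, V)\<in>P. (f -` U \<inter> space N) \<inter> (g -` V \<inter> space N))" using x by blast
  next
    fix x assume "x \<in> (\<Union>(U, V)\<in>P. (f -` U \<inter> space N) \<inter> (g -` V \<inter> space N))"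
    then obtain U V where "(U, V) \<in> P" "f x \<in> U" "g x \<in> V" "x \<in> space N" by blast
    then show "x \<in> {x \<in> space N. f x \<noteq> g x}" using separating_pairsD(4)[OF P] unfolding disjnt_iff by force
  qed
  also have "\<dots> \<in> sets N"
  proof (intro sets.countable_UN' separating_pairsD(1)[OF P], clarify)
    fix U V assume "(U, V) \<in> P"
    then have "U \<in> sets M" "V \<in> sets M" using separating_pairsD(2,3)[OF P] closed by auto
    then show "(f -` U \<inter> space N) \<inter> (g -` V \<inter> space N) \<in> sets N"
      using assms(2,3) by (intro sets.Int measurable_sets)
  qed
  finally show ?thesis .
qed

lemma standard_borel_singleton:
  assumes "standard_borel M" "x \<in> space M"
  shows "{x} \<in> sets M"
proof -
  have "space M - {y \<in> space M. y \<noteq> x} \<in> sets M"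
    using standard_borel_neq_sets[OF assms(1), of "\<lambda>y. y" M "\<lambda>_. x"] assms(2) by (intro sets.Diff) simp_all
  moreover have "space M - {y \<in> space M. y \<noteq> x} = {x}" using assms(2) by blast
  ultimately show ?thesis by simp
qed

lemma standard_borel_countable:
  assumes "standard_borel M" "countable C" "C \<subseteq> space M"
  shows "C \<in> sets M"
proof -
  have "(\<Union>x\<in>C. {x}) \<in> sets M"
    using assms(2,3) standard_borel_singleton[OF assms(1)] by (intro sets.countable_UN') blast+
  then show ?thesis by simp
qed

text \<open>The binary sequence of a real number records its comparisons with all rationals, so that it
  determines the number; the image of the uniform distribution on the unit interval is therefore
  diffuse.\<close>

lemma standard_borel_diffuse_measure:
  assumes M: "standard_borel M" and B: "B \<in> sets M" "uncountable B"
  obtains \<mu> where "\<mu> \<in> prob_measures M" "measure \<mu> B = 1"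
    "\<And>C. countable C \<Longrightarrow> C \<subseteq> space M \<Longrightarrow> measure \<mu> C = 0"
proof -
  obtain X P where X: "topspace X = space M" "sets M = sigma_sets (space M) {U. openin X U}"
    and scheme: "\<And>B. B \<in> sets M \<Longrightarrow> \<exists>A. suslin_scheme X B A"
    and P: "separating_pairs X P"
    by (metis standard_borelE[OF M])
  obtain A where A: "suslin_scheme X B A" using scheme[OF B(1)] by blast
  have BX: "B \<subseteq> topspace X" using sets.sets_into_space[OF B(1)] X(1) by simp
  obtain \<phi> :: "(nat \<Rightarrow> bool) \<Rightarrow> 'a" where \<phi>: "inj \<phi>" "range \<phi> \<subseteq> B"
    "\<And>U b. openin X U \<Longrightarrow> \<phi> b \<in> U \<Longrightarrow> \<exists>n. \<forall>b'. (\<forall>i<n. b' i = b i) \<longrightarrow> \<phi> b' \<in> U"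
    by (rule suslin_scheme_Cantor_embedding[OF A BX B(2) P]) blast
  define \<beta> :: "real \<Rightarrow> nat \<Rightarrow> bool" where "\<beta> r n \<longleftrightarrow> r < of_rat (from_nat n)" for r n
  have "inj \<beta>"
  proof (rule injI)
    fix r s assume eq: "\<beta> r = \<beta> s"
    have "r < of_rat q \<longleftrightarrow> s < of_rat q" for q
      using fun_cong[OF eq, of "to_nat q"] by (simp add: \<beta>_def)
    then show "r = s" by (metis linorder_neq_iff of_rat_dense order_less_asym)
  qed
  define f where "f = \<phi> \<circ> \<beta>"
  have inj: "inj f" unfolding f_def using \<phi>(1) \<open>inj \<beta>\<close> by (rule inj_compose)
  have fB: "f r \<in> B" for r using \<phi>(2) unfolding f_def by auto
  have f: "f \<in> lborel \<rightarrow>\<^sub>M M"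
  proof (rule measurable_sigma_sets[OF X(2)])
    show "{U. openin X U} \<subseteq> Pow (space M)" using openin_subset X(1) by blast
    show "f \<in> space lborel \<rightarrow> space M" using fB BX X(1) by auto
    fix U assume U: "U \<in> {U. openin X U}"
    \<comment> \<open>\<open>W\<close> consists of the finite binary words whose whole cylinder is
      mapped into \<open>U\<close>. Continuity of \<open>\<phi>\<close> makes the preimage of
      \<open>U\<close> the union of these cylinders, of which there are countably many.\<close>
    define W where "W = {w. \<forall>b. (\<forall>i<length w. b i = w ! i) \<longrightarrow> \<phi> b \<in> U}"
    have "f -` U = (\<Union>w\<in>W. {r. \<forall>i<length w. \<beta> r i = w ! i})"
    proof (intro equalityI subsetI)
      fix r assume "r \<in> f -` U"
      then obtain n where n: "\<forall>b. (\<forall>i<n. b i = \<beta> r i) \<longrightarrow> \<phi> b \<in> U"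
        using \<phi>(3)[of U "\<beta> r"] U by (auto simp: f_def)
      show "r \<in> (\<Union>w\<in>W. {r. \<forall>i<length w. \<beta> r i = w ! i})"
        by (rule UN_I[of "map (\<beta> r) [0..<n]"]) (use n in \<open>auto simp: W_def\<close>)
    qed (auto simp: W_def f_def)
    moreover have "{r. \<forall>i<length w. \<beta> r i = w ! i} \<in> sets borel" for w
    proof -
      have "Measurable.pred borel (\<lambda>r. \<beta> r i)" for i
        unfolding \<beta>_def by measurable
      then have "Measurable.pred borel (\<lambda>r. \<forall>i. i < length w \<longrightarrow> \<beta> r i = w ! i)"
        by (intro pred_intros_countable(1) pred_intros_logic(4,6)) simp_all
      then show ?thesis by (simp only: pred_def space_borel UNIV_I simp_thms)
    qed
    then have "(\<Union>w\<in>W. {r. \<forall>i<length w. \<beta> r i = w ! i}) \<in> sets borel"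
      by (intro sets.countable_UN') blast+
    ultimately show "f -` U \<inter> space lborel \<in> sets lborel" by (simp only: space_lborel space_borel sets_lborel Int_UNIV_right)
  qed
  define R where "R = uniform_measure lborel {0..1::real}"
  interpret R: prob_space R unfolding R_def by (rule prob_space_uniform_measure) simp_all
  have fR: "f \<in> R \<rightarrow>\<^sub>M M" using f unfolding R_def by simp
  define \<mu> where "\<mu> = distr R M f"
  have \<mu>: "measure \<mu> Y = measure R (f -` Y)" if "Y \<in> sets M" for Y
    unfolding \<mu>_def using measure_distr[OF fR that] by (simp add: R_def)
  show thesis
  proof
    show "\<mu> \<in> prob_measures M"
      unfolding prob_measures_def \<mu>_def using R.prob_space_distr[OF fR] by simp
    have "f -` B = space R" using fB by (auto simp: R_def)
    then show "measure \<mu> B = 1" using \<mu>[OF B(1)] R.prob_space by simp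
    fix C assume C: "countable C" "C \<subseteq> space M"
    \<comment> \<open>Injectivity of \<open>f\<close> makes the preimage of a countable set
      countable, hence a Lebesgue null set.\<close>
    have "countable (f ` (f -` C))" using C(1) by (rule countable_subset[rotated]) blast
    then have countable: "countable (f -` C)"
      by (rule countable_image_inj_on) (rule inj_on_subset[OF inj subset_UNIV])
    then have "emeasure lborel ({0..1} \<inter> f -` C) = 0"
      by (intro emeasure_lborel_countable) simp
    then have "emeasure R (f -` C) = 0"
      unfolding R_def using countable by (subst emeasure_uniform_measure) (simp_all add: sets.countable)
    then show "measure \<mu> C = 0"
      using \<mu>[OF standard_borel_countable[OF M C]] by (simp add: measure_def)
  qed
qed

subsection \<open>Full groups in the automorphism group\<close>

lemma borel_aut_closed: "T \<in> borel_aut M \<Longrightarrow> x \<in> space M \<Longrightarrow> T x \<in> space M"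
  by (auto simp: borel_aut_def measurable_def)

lemma borel_aut_measurable: "T \<in> borel_aut M \<Longrightarrow> T \<in> M \<rightarrow>\<^sub>M M"
  by (simp add: borel_aut_def)

lemma borel_aut_inj:
  "T \<in> borel_aut M \<Longrightarrow> x \<in> space M \<Longrightarrow> y \<in> space M \<Longrightarrow> T x = T y \<longleftrightarrow> x = y"
  by (auto simp: borel_aut_def Bij_def bij_betw_def inj_on_def)

lemma ainv_borel_aut: "T \<in> borel_aut M \<Longrightarrow> ainv M T \<in> borel_aut M"
  using group.inv_closed[OF group_Aut] by (simp add: carrier_Aut)

lemma borel_aut_ainv: "T \<in> borel_aut M \<Longrightarrow> x \<in> space M \<Longrightarrow> T (ainv M T x) = x"
  by (auto simp: ainv_eq borel_aut_def Bij_def bij_betw_inv_into_right)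

lemma ainv_borel_aut_apply: "T \<in> borel_aut M \<Longrightarrow> x \<in> space M \<Longrightarrow> ainv M T (T x) = x"
  by (metis ainv_borel_aut borel_aut_ainv borel_aut_closed borel_aut_inj)

lemma borel_aut_image_sets:
  assumes "T \<in> borel_aut M" "F \<in> sets M"
  shows "T ` F \<in> sets M"
proof -
  have F: "F \<subseteq> space M" using assms(2) by (rule sets.sets_into_space)
  have "T ` F = ainv M T -` F \<inter> space M"
  proof (intro equalityI subsetI)
    fix y assume "y \<in> T ` F"
    then show "y \<in> ainv M T -` F \<inter> space M"
      using F assms(1) by (auto simp: ainv_borel_aut_apply borel_aut_closed)
  next
    fix y assume "y \<in> ainv M T -` F \<inter> space M"
    then show "y \<in> T ` F" using borel_aut_ainv[OF assms(1)] by (metis IntE imageI vimageE)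
  qed
  also have "\<dots> \<in> sets M"
    using borel_aut_measurable[OF ainv_borel_aut[OF assms(1)]] assms(2) by (rule measurable_sets)
  finally show ?thesis .
qed

lemma diff_set_sets:
  assumes "standard_borel M" "S \<in> borel_aut M" "T \<in> borel_aut M"
  shows "diff_set M S T \<in> sets M"
  unfolding diff_set_def
  by (intro sets.Un standard_borel_neq_sets[OF assms(1)] borel_aut_measurable ainv_borel_aut assms)

lemma return_prob_measures: "x \<in> space M \<Longrightarrow> return M x \<in> prob_measures M"
  by (simp add: prob_measures_def prob_space_return)

lemma prob_measures_le_1: "\<mu> \<in> prob_measures M \<Longrightarrow> measure \<mu> A \<le> 1"
  by (simp add: prob_measures_def prob_space.prob_le_1)

lemma bounded_borel_indicator: "F \<in> sets M \<Longrightarrow> indicator F \<in> bounded_borel M"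
  by (auto simp: bounded_borel_def indicator_def bounded_iff intro!: exI[of _ 1])

lemma bdd_above_bounded_borel:
  "f \<in> bounded_borel M \<Longrightarrow> bdd_above ((\<lambda>x. \<bar>f x\<bar>) ` space M)"
  by (auto simp: bounded_borel_def bounded_iff bdd_above_def)

lemma le_sup_norm: "f \<in> bounded_borel M \<Longrightarrow> x \<in> space M \<Longrightarrow> \<bar>f x\<bar> \<le> sup_norm M f"
  unfolding sup_norm_def by (intro cSUP_upper bdd_above_bounded_borel)

lemma bounded_borel1_indicator:
  assumes "F \<in> sets M" "space M \<noteq> {}"
  shows "indicator F \<in> bounded_borel1 M"
  using assms bounded_borel_indicator[OF assms(1)]
  by (auto simp: bounded_borel1_def sup_norm_def indicator_def intro!: cSUP_least)

section \<open>Closedness from neighbourhoods that fix the value at a point\<close>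

lemma closedin_full_group:
  assumes top: "topspace X = borel_aut M"
    and loc: "\<And>S x. S \<in> borel_aut M \<Longrightarrow> x \<in> space M \<Longrightarrow>
      \<exists>U. openin X U \<and> S \<in> U \<and> (\<forall>R\<in>U. R x = S x)"
  shows "closedin X (full_group M T)"
  unfolding closedin_def
proof
  show "full_group M T \<subseteq> topspace X" by (auto simp: full_group_def top)
  show "openin X (topspace X - full_group M T)"
  proof (subst openin_subopen, intro ballI)
    fix S assume "S \<in> topspace X - full_group M T"
    then obtain x where x: "S \<in> borel_aut M" "x \<in> space M" "S x \<notin> Orb M T x"
      by (auto simp: top full_group_def)
    obtain U where U: "openin X U" "S \<in> U" "\<forall>R\<in>U. R x = S x" using loc[OF x(1,2)] by blast
    have "R \<notin> full_group M T" if "R \<in> U" for R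
      using U(3) that x(2,3) unfolding full_group_def by force
    then have "U \<subseteq> topspace X - full_group M T" using openin_subset[OF U(1)] by blast
    then show "\<exists>U. openin X U \<and> S \<in> U \<and> U \<subseteq> topspace X - full_group M T" using U(1,2) by blast
  qed
qed

lemma topspace_generated_by_eqI:
  assumes "\<And>U. U \<in> \<B> \<Longrightarrow> U \<subseteq> A" "\<And>x. x \<in> A \<Longrightarrow> \<exists>U\<in>\<B>. x \<in> U"
  shows "topspace (topology_generated_by \<B>) = A"
  unfolding topology_generated_by_topspace
proof
  show "\<Union>\<B> \<subseteq> A" using assms(1) by (rule Union_least)
  show "A \<subseteq> \<Union>\<B>" using assms(2) by auto
qed

lemma closedin_full_group_generated:
  assumes "\<And>U. U \<in> \<B> \<Longrightarrow> U \<subseteq> borel_aut M" "space M \<noteq> {}"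
    and loc: "\<And>S x. S \<in> borel_aut M \<Longrightarrow> x \<in> space M \<Longrightarrow> \<exists>U\<in>\<B>. S \<in> U \<and> (\<forall>R\<in>U. R x = S x)"
  shows "closedin (topology_generated_by \<B>) (full_group M T)"
proof (rule closedin_full_group)
  show "topspace (topology_generated_by \<B>) = borel_aut M"
  proof (rule topspace_generated_by_eqI)
    \<comment> \<open>Any point serves to obtain from \<open>loc\<close> a generating set around
      \<open>S\<close>, so that these sets cover the group.\<close>
    obtain x where "x \<in> space M" using assms(2) by blast
    then show "\<exists>U\<in>\<B>. S \<in> U" if "S \<in> borel_aut M" for S using loc[OF that] by blast
  qed (rule assms(1))
  fix S x assume "S \<in> borel_aut M" "x \<in> space M"
  then obtain U where "U \<in> \<B>" "S \<in> U" "\<forall>R\<in>U. R x = S x" using loc by blast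
  then show "\<exists>U. openin (topology_generated_by \<B>) U \<and> S \<in> U \<and> (\<forall>R\<in>U. R x = S x)"
    using topology_generated_by_Basis by blast
qed

lemma closedin_tau_full_group:
  assumes "standard_borel M" "space M \<noteq> {}"
  shows "closedin (tau M) (full_group M T)"
  unfolding tau_def
proof (rule closedin_full_group_generated[OF _ assms(2)])
  fix S x assume S: "S \<in> borel_aut M" and x: "x \<in> space M"
  \<comment> \<open>The point mass at \<open>x\<close> takes only the values 0 and 1 on measurable
    sets, so a value below 1 means that \<open>x\<close> is not in
    \<open>diff_set M R S\<close>.\<close>
  have "R x = S x" if "R \<in> tau_nbhd M S {return M x} 1" for R
  proof (rule ccontr)
    assume "R x \<noteq> S x"
    then have "x \<in> diff_set M R S" using x by (simp add: diff_set_def eq_commute)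
    then show False
      using that S x diff_set_sets[OF assms(1), of R S] by (auto simp: tau_nbhd_def measure_return)
  qed
  moreover have "S \<in> tau_nbhd M S {return M x} 1" using S by (simp add: tau_nbhd_def diff_set_def)
  ultimately show "\<exists>U\<in>{tau_nbhd M T \<M> \<epsilon> |T \<M> \<epsilon>. T \<in> borel_aut M \<and> finite \<M> \<and>
      \<M> \<subseteq> prob_measures M \<and> 0 < \<epsilon>}. S \<in> U \<and> (\<forall>R\<in>U. R x = S x)"
    using S return_prob_measures[OF x]
    by (intro bexI[of _ "tau_nbhd M S {return M x} 1"] conjI ballI CollectI exI) (rule refl | assumption | simp)+
qed (auto simp: tau_nbhd_def)

text \<open>For \<open>F = {x}\<close> and \<open>R x \<noteq> S x\<close> the point
  \<open>S x\<close> lies in the symmetric difference of the images, which then has point mass 1 at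
  \<open>S x\<close>.\<close>

lemma closedin_tau'_full_group:
  assumes "standard_borel M" "space M \<noteq> {}"
  shows "closedin (tau' M) (full_group M T)"
  unfolding tau'_def
proof (rule closedin_full_group_generated[OF _ assms(2)])
  fix S x assume S: "S \<in> borel_aut M" and x: "x \<in> space M"
  let ?\<mu> = "return M (S x)"
  have Sx: "S x \<in> space M" using S x by (rule borel_aut_closed)
  have "R x = S x" if R: "R \<in> tau'_nbhd M S {?\<mu>} 1" for R
  proof (rule ccontr)
    assume ne: "R x \<noteq> S x"
    have Rb: "R \<in> borel_aut M" using R by (simp add: tau'_nbhd_def)
    have "sym_diff (S ` {x}) (R ` {x}) \<in> sets M"
      using S Rb standard_borel_singleton[OF assms(1) x] by (intro sets.Un sets.Diff borel_aut_image_sets)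
    then have "measure ?\<mu> (sym_diff (S ` {x}) (R ` {x})) = 1"
      using ne Sx by (subst measure_return) simp_all
    moreover have "measure ?\<mu> (sym_diff (S ` {x}) (R ` {x})) \<le>
        (SUP F\<in>sets M. measure ?\<mu> (sym_diff (S ` F) (R ` F)))"
      using prob_measures_le_1[OF return_prob_measures[OF Sx]] standard_borel_singleton[OF assms(1) x]
      by (intro cSUP_upper bdd_aboveI2[of _ _ 1])
    ultimately show False using R by (simp add: tau'_nbhd_def)
  qed
  \<comment> \<open>At \<open>R = S\<close> the supremum runs over zeros; evaluating it as 0
    requires a nonempty index set.\<close>
  moreover have "sets M \<noteq> {}" using sets.top by blast
  then have "S \<in> tau'_nbhd M S {?\<mu>} 1" using S by (simp add: tau'_nbhd_def)
  ultimately show "\<exists>U\<in>{tau'_nbhd M T \<M> \<epsilon> |T \<M> \<epsilon>. T \<in> borel_aut M \<and> finite \<M> \<and>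
      \<M> \<subseteq> prob_measures M \<and> 0 < \<epsilon>}. S \<in> U \<and> (\<forall>R\<in>U. R x = S x)"
    using S return_prob_measures[OF Sx]
    by (intro bexI[of _ "tau'_nbhd M S {?\<mu>} 1"] conjI ballI CollectI exI) (rule refl | assumption | simp)+
qed (auto simp: tau'_nbhd_def)

lemma push_integral_return:
  assumes "S \<in> borel_aut M" "y \<in> space M" "f \<in> borel_measurable M"
  shows "push_integral M (return M y) S f = f (ainv M S y)"
  unfolding push_integral_def
  using assms measurable_compose[OF borel_aut_measurable[OF ainv_borel_aut[OF assms(1)]] assms(3)]
  by (subst integral_return) simp_all

text \<open>Against the point mass at \<open>S x\<close>, the push-forward integral of the indicator
  of \<open>{x}\<close> is its value at \<open>ainv M R (S x)\<close>, which is 1 exactly if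
  \<open>R x = S x\<close>.\<close>

lemma closedin_tau''_full_group:
  assumes "standard_borel M" "space M \<noteq> {}"
  shows "closedin (tau'' M) (full_group M T)"
  unfolding tau''_def
proof (rule closedin_full_group_generated[OF _ assms(2)])
  fix S x assume S: "S \<in> borel_aut M" and x: "x \<in> space M"
  let ?\<mu> = "return M (S x)"
  have Sx: "S x \<in> space M" using S x by (rule borel_aut_closed)
  let ?f = "indicator {x} :: 'a \<Rightarrow> real"
  have f: "?f \<in> bounded_borel1 M"
    using standard_borel_singleton[OF assms(1) x] assms(2) by (rule bounded_borel1_indicator)
  have "R x = S x" if R: "R \<in> tau''_nbhd M S {?\<mu>} 1" for R
  proof -
    have Rb: "R \<in> borel_aut M" using R by (simp add: tau''_nbhd_def)
    have eq: "push_integral M ?\<mu> Q g = g (ainv M Q (S x))"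
      if "Q \<in> borel_aut M" "g \<in> bounded_borel1 M" for Q g
      using that Sx by (intro push_integral_return) (simp_all add: bounded_borel1_def bounded_borel_def)
    \<comment> \<open>The bound makes the family bounded above, so that its supremum really
      dominates the member for \<open>?f\<close>.\<close>
    have "\<bar>push_integral M ?\<mu> R g - push_integral M ?\<mu> S g\<bar> \<le> 2" if g: "g \<in> bounded_borel1 M" for g
    proof -
      have "\<bar>g z\<bar> \<le> 1" if "z \<in> space M" for z
        using le_sup_norm[of g M z] g that by (simp add: bounded_borel1_def)
      from this[of "ainv M R (S x)"] this[of "ainv M S (S x)"] show ?thesis
        using S Rb Sx by (simp add: eq g borel_aut_closed ainv_borel_aut)
    qed
    then have "\<bar>push_integral M ?\<mu> R ?f - push_integral M ?\<mu> S ?f\<bar> \<le>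
        (SUP g\<in>bounded_borel1 M. \<bar>push_integral M ?\<mu> R g - push_integral M ?\<mu> S g\<bar>)"
      using f by (intro cSUP_upper bdd_aboveI2[of _ _ 2])
    also have "\<dots> < 1" using R by (simp add: tau''_nbhd_def)
    finally have "\<bar>?f (ainv M R (S x)) - ?f x\<bar> < 1"
      using S Rb x f by (simp add: eq ainv_borel_aut_apply)
    then have "ainv M R (S x) = x" by (simp add: indicator_def split: if_splits)
    then show "R x = S x" using borel_aut_ainv[OF Rb Sx] by simp
  qed
  moreover have "bounded_borel1 M \<noteq> {}" using f by blast
  then have "S \<in> tau''_nbhd M S {?\<mu>} 1" using S by (simp add: tau''_nbhd_def)
  ultimately show "\<exists>U\<in>{tau''_nbhd M T \<M> \<epsilon> |T \<M> \<epsilon>. T \<in> borel_aut M \<and> finite \<M> \<and>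
      \<M> \<subseteq> prob_measures M \<and> 0 < \<epsilon>}. S \<in> U \<and> (\<forall>R\<in>U. R x = S x)"
    using S return_prob_measures[OF Sx]
    by (intro bexI[of _ "tau''_nbhd M S {?\<mu>} 1"] conjI ballI CollectI exI) (rule refl | assumption | simp)+
qed (auto simp: tau''_nbhd_def)

lemma closedin_p_top_full_group:
  assumes "standard_borel M" "space M \<noteq> {}"
  shows "closedin (p_top M) (full_group M T)"
  unfolding p_top_def
proof (rule closedin_full_group_generated[OF _ assms(2)])
  fix S x assume S: "S \<in> borel_aut M" and x: "x \<in> space M"
  have "R x = S x" if "R \<in> p_nbhd M S {{x}}" for R
    using that by (simp add: p_nbhd_def)
  moreover have "S \<in> p_nbhd M S {{x}}" using S by (simp add: p_nbhd_def)
  ultimately show "\<exists>U\<in>{p_nbhd M T \<F> |T \<F>. T \<in> borel_aut M \<and> finite \<F> \<and> \<F> \<subseteq> sets M}.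
      S \<in> U \<and> (\<forall>R\<in>U. R x = S x)"
    using S standard_borel_singleton[OF assms(1) x]
    by (intro bexI[of _ "p_nbhd M S {{x}}"] conjI ballI CollectI exI) (rule refl | assumption | simp)+
qed (auto simp: p_nbhd_def)

text \<open>Evaluated at \<open>S x\<close>, a difference of indicator values below 1 in modulus
  must be 0, which puts the preimage of \<open>S x\<close> under \<open>R\<close> at
  \<open>x\<close>.\<close>

lemma closedin_p_tilde_full_group:
  assumes "standard_borel M" "space M \<noteq> {}"
  shows "closedin (p_tilde M) (full_group M T)"
  unfolding p_tilde_def
proof (rule closedin_full_group_generated[OF _ assms(2)])
  fix S x assume S: "S \<in> borel_aut M" and x: "x \<in> space M"
  let ?f = "indicator {x} :: 'a \<Rightarrow> real"
  have Sx: "S x \<in> space M" using S x by (rule borel_aut_closed)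
  have f: "?f \<in> bounded_borel M"
    using standard_borel_singleton[OF assms(1) x] by (rule bounded_borel_indicator)
  have "R x = S x" if R: "R \<in> p_tilde_nbhd M S {?f} 1" for R
  proof -
    have Rb: "R \<in> borel_aut M" using R by (simp add: p_tilde_nbhd_def)
    let ?g = "\<lambda>y. ?f (ainv M S y) - ?f (ainv M R y)"
    have "\<bar>?g (S x)\<bar> \<le> sup_norm M ?g"
      unfolding sup_norm_def using Sx by (intro cSUP_upper bdd_aboveI2[of _ _ 1]) (auto simp: indicator_def)
    also have "\<dots> < 1" using R by (simp add: p_tilde_nbhd_def)
    finally have "ainv M R (S x) = x"
      using S x by (simp add: ainv_borel_aut_apply indicator_def split: if_splits)
    then show "R x = S x" using borel_aut_ainv[OF Rb Sx] by simp
  qed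
  moreover have "S \<in> p_tilde_nbhd M S {?f} 1"
    using S assms(2) by (simp add: p_tilde_nbhd_def sup_norm_def)
  ultimately show "\<exists>U\<in>{p_tilde_nbhd M T \<Phi> \<epsilon> |T \<Phi> \<epsilon>. T \<in> borel_aut M \<and> finite \<Phi> \<and>
      \<Phi> \<subseteq> bounded_borel M \<and> 0 < \<epsilon>}. S \<in> U \<and> (\<forall>R\<in>U. R x = S x)"
    using S f by (intro bexI[of _ "p_tilde_nbhd M S {?f} 1"] conjI ballI CollectI exI) (rule refl | assumption | simp)+
qed (auto simp: p_tilde_nbhd_def)

text \<open>If \<open>R x \<noteq> S x\<close>, then the first summand for \<open>{x}\<close> and
  the point mass at \<open>S x\<close> is 1, and the second is nonnegative, so that their sum is not
  below 1.\<close>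

lemma closedin_p_bar_full_group:
  assumes "standard_borel M" "space M \<noteq> {}"
  shows "closedin (p_bar M) (full_group M T)"
  unfolding p_bar_def
proof (rule closedin_full_group_generated[OF _ assms(2)])
  fix S x assume S: "S \<in> borel_aut M" and x: "x \<in> space M"
  let ?\<mu> = "return M (S x)"
  have Sx: "S x \<in> space M" using S x by (rule borel_aut_closed)
  have "R x = S x" if R: "R \<in> p_bar_nbhd M S {{x}} {?\<mu>} 1" for R
  proof (rule ccontr)
    assume ne: "R x \<noteq> S x"
    have Rb: "R \<in> borel_aut M" using R by (simp add: p_bar_nbhd_def)
    have "sym_diff (R ` {x}) (S ` {x}) \<in> sets M"
      using S Rb standard_borel_singleton[OF assms(1) x] by (intro sets.Un sets.Diff borel_aut_image_sets)
    then have "measure ?\<mu> (sym_diff (R ` {x}) (S ` {x})) = 1"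
      using ne Sx by (subst measure_return) simp_all
    moreover have "measure ?\<mu> (sym_diff (ainv M R ` {x}) (ainv M S ` {x})) \<ge> 0" by simp
    ultimately show False using R by (simp add: p_bar_nbhd_def)
  qed
  moreover have "S \<in> p_bar_nbhd M S {{x}} {?\<mu>} 1" using S by (simp add: p_bar_nbhd_def)
  ultimately show "\<exists>U\<in>{p_bar_nbhd M T \<F> \<M> \<epsilon> |T \<F> \<M> \<epsilon>. T \<in> borel_aut M \<and> finite \<F> \<and>
      \<F> \<subseteq> sets M \<and> finite \<M> \<and> \<M> \<subseteq> prob_measures M \<and> 0 < \<epsilon>}. S \<in> U \<and> (\<forall>R\<in>U. R x = S x)"
    using S return_prob_measures[OF Sx] standard_borel_singleton[OF assms(1) x]
    by (intro bexI[of _ "p_bar_nbhd M S {{x}} {?\<mu>} 1"] conjI ballI CollectI exI) (rule refl | assumption | simp)+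
qed (auto simp: p_bar_nbhd_def)

subsection \<open>Full groups modulo countable sets\<close>

lemma int_pow_borel_aut: "T \<in> borel_aut M \<Longrightarrow> T [^]\<^bsub>Aut M\<^esub> (n::int) \<in> borel_aut M"
  using group.int_pow_closed[OF group_Aut] by (simp add: carrier_Aut)

lemma Orb_refl: "x \<in> space M \<Longrightarrow> x \<in> Orb M T x"
  unfolding Orb_def by (intro CollectI exI[of _ 0]) (simp add: int_pow_0 Aut_def BijGroup_def)

lemma int_pow_apply_add:
  assumes "T \<in> borel_aut M" "x \<in> space M"
  shows "(T [^]\<^bsub>Aut M\<^esub> (m + n :: int)) x = (T [^]\<^bsub>Aut M\<^esub> m) ((T [^]\<^bsub>Aut M\<^esub> n) x)"
  using group.int_pow_mult[OF group_Aut, of T M m n] assms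
  by (simp add: carrier_Aut mult_Aut int_pow_borel_aut compose_def)

lemma Orb_trans:
  assumes "T \<in> borel_aut M" "x \<in> space M" "y \<in> Orb M T x" "z \<in> Orb M T y"
  shows "z \<in> Orb M T x"
proof -
  obtain m n where "y = (T [^]\<^bsub>Aut M\<^esub> (m::int)) x" "z = (T [^]\<^bsub>Aut M\<^esub> (n::int)) y"
    using assms(3,4) unfolding Orb_def by blast
  then have "z = (T [^]\<^bsub>Aut M\<^esub> (n + m)) x" using int_pow_apply_add[OF assms(1,2)] by simp
  then show ?thesis unfolding Orb_def by blast
qed

lemma Orb_sym:
  assumes "T \<in> borel_aut M" "x \<in> space M" "y \<in> Orb M T x"
  shows "x \<in> Orb M T y"
proof -
  obtain m where m: "y = (T [^]\<^bsub>Aut M\<^esub> (m::int)) x" using assms(3) unfolding Orb_def by blast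
  have "(T [^]\<^bsub>Aut M\<^esub> (- m)) y = (T [^]\<^bsub>Aut M\<^esub> (- m + m)) x"
    unfolding m by (rule int_pow_apply_add[OF assms(1,2), symmetric])
  then have "x = (T [^]\<^bsub>Aut M\<^esub> (- m)) y"
    using assms(2) by (simp add: Aut_def BijGroup_def)
  then show ?thesis unfolding Orb_def by blast
qed

definition off_orbit :: "'a measure \<Rightarrow> ('a \<Rightarrow> 'a) \<Rightarrow> ('a \<Rightarrow> 'a) \<Rightarrow> 'a set" where
  "off_orbit M T \<gamma> = {x \<in> space M. \<gamma> x \<notin> Orb M T x}"

text \<open>This is the preimage under \<open>hat_class\<close> of the full group in the quotient,
  when \<open>T\<close> is an automorphism; closedness in the quotient topology is tested on
  it.\<close>

definition almost_full_group :: "'a measure \<Rightarrow> ('a \<Rightarrow> 'a) \<Rightarrow> ('a \<Rightarrow> 'a) set" where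
  "almost_full_group M T = {\<gamma> \<in> borel_aut M. countable (off_orbit M T \<gamma>)}"

lemma full_group_hat_eq: "full_group_hat M T = hat_class M ` almost_full_group M T"
  by (auto simp: full_group_hat_def almost_full_group_def off_orbit_def)

text \<open>Leaving the orbit means differing from each of the countably many powers of
  \<open>T\<close>.\<close>

lemma off_orbit_sets:
  assumes "standard_borel M" "T \<in> borel_aut M" "\<gamma> \<in> borel_aut M"
  shows "off_orbit M T \<gamma> \<in> sets M"
proof -
  have "off_orbit M T \<gamma> = {x \<in> space M. \<forall>n::int. \<gamma> x \<noteq> (T [^]\<^bsub>Aut M\<^esub> n) x}"
    by (auto simp: off_orbit_def Orb_def)
  also have "\<dots> \<in> sets M"
    by (intro sets.sets_Collect_countable_All standard_borel_neq_sets[OF assms(1)] borel_aut_measurable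
        int_pow_borel_aut assms)
  finally show ?thesis .
qed

text \<open>Lying on the same orbit is an equivalence relation. Hence the exceptional sets of
  inverses and products are covered by the countable exceptional sets of the given automorphisms and
  their images.\<close>

lemma subgroup_almost_full_group:
  assumes T: "T \<in> borel_aut M"
  shows "subgroup (almost_full_group M T) (Aut M)"
proof -
  interpret group "Aut M" by (rule group_Aut)
  show ?thesis
  proof (rule subgroupI)
    show "almost_full_group M T \<subseteq> carrier (Aut M)" by (auto simp: almost_full_group_def carrier_Aut)
    have "off_orbit M T \<one>\<^bsub>Aut M\<^esub> = {}"
      using Orb_refl by (auto simp: off_orbit_def Aut_def BijGroup_def)
    then show "almost_full_group M T \<noteq> {}"
      using one_closed by (auto simp: almost_full_group_def carrier_Aut)
  next
    fix \<gamma> assume "\<gamma> \<in> almost_full_group M T"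
    then have g: "\<gamma> \<in> borel_aut M" "countable (off_orbit M T \<gamma>)" by (auto simp: almost_full_group_def)
    have "off_orbit M T (ainv M \<gamma>) \<subseteq> \<gamma> ` off_orbit M T \<gamma>"
    proof
      fix x assume x: "x \<in> off_orbit M T (ainv M \<gamma>)"
      let ?y = "ainv M \<gamma> x"
      have xs: "x \<in> space M" using x by (simp add: off_orbit_def)
      then have y: "?y \<in> space M" "\<gamma> ?y = x"
        using g by (simp_all add: borel_aut_closed ainv_borel_aut borel_aut_ainv)
      then have "\<gamma> ?y \<notin> Orb M T ?y" using Orb_sym[OF T y(1)] x by (auto simp: off_orbit_def)
      then show "x \<in> \<gamma> ` off_orbit M T \<gamma>" using y by (force simp: off_orbit_def)
    qed
    then show "ainv M \<gamma> \<in> almost_full_group M T"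
      using g countable_subset[OF _ countable_image[OF g(2)]] by (simp add: almost_full_group_def ainv_borel_aut)
  next
    fix \<gamma> \<delta> assume "\<gamma> \<in> almost_full_group M T" "\<delta> \<in> almost_full_group M T"
    then have g: "\<gamma> \<in> borel_aut M" "countable (off_orbit M T \<gamma>)"
      and d: "\<delta> \<in> borel_aut M" "countable (off_orbit M T \<delta>)" by (auto simp: almost_full_group_def)
    have "off_orbit M T (compose (space M) \<gamma> \<delta>) \<subseteq> off_orbit M T \<delta> \<union> ainv M \<delta> ` off_orbit M T \<gamma>"
    proof
      fix x assume "x \<in> off_orbit M T (compose (space M) \<gamma> \<delta>)"
      then have x: "x \<in> space M" "\<gamma> (\<delta> x) \<notin> Orb M T x" by (auto simp: off_orbit_def compose_def)
      show "x \<in> off_orbit M T \<delta> \<union> ainv M \<delta> ` off_orbit M T \<gamma>"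
      proof (cases "\<delta> x \<in> Orb M T x")
        case True
        then have "\<delta> x \<in> off_orbit M T \<gamma>"
          using Orb_trans[OF T x(1) True] x d(1) by (auto simp: off_orbit_def borel_aut_closed)
        then show ?thesis using ainv_borel_aut_apply[OF d(1) x(1)] by (metis UnI2 imageI)
      qed (use x in \<open>simp add: off_orbit_def\<close>)
    qed
    moreover have "countable (off_orbit M T \<delta> \<union> ainv M \<delta> ` off_orbit M T \<gamma>)" using g d by simp
    ultimately have "countable (off_orbit M T (compose (space M) \<gamma> \<delta>))" by (rule countable_subset)
    then show "\<gamma> \<otimes>\<^bsub>Aut M\<^esub> \<delta> \<in> almost_full_group M T"
      using m_closed[of \<gamma> \<delta>] g d by (simp add: almost_full_group_def carrier_Aut mult_Aut)
  qed
qed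

lemma Ctbl_subset_almost_full_group: "Ctbl M \<subseteq> almost_full_group M T"
proof
  fix \<gamma> assume "\<gamma> \<in> Ctbl M"
  moreover have "off_orbit M T \<gamma> \<subseteq> {x \<in> space M. \<gamma> x \<noteq> x}" by (auto simp: off_orbit_def Orb_refl)
  ultimately show "\<gamma> \<in> almost_full_group M T"
    using countable_subset by (auto simp: Ctbl_def almost_full_group_def)
qed

text \<open>The set \<open>almost_full_group M T\<close> is a union of cosets of
  \<open>Ctbl M\<close>, since it is a subgroup containing \<open>Ctbl M\<close>. So membership of a
  class does not depend on the representative.\<close>

lemma hat_class_mem_full_group_hat_iff:
  assumes T: "T \<in> borel_aut M" and S: "S \<in> borel_aut M"
  shows "hat_class M S \<in> full_group_hat M T \<longleftrightarrow> S \<in> almost_full_group M T"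
proof
  interpret group "Aut M" by (rule group_Aut)
  assume "hat_class M S \<in> full_group_hat M T"
  then obtain \<gamma> where \<gamma>: "\<gamma> \<in> almost_full_group M T" "hat_class M S = hat_class M \<gamma>"
    unfolding full_group_hat_eq by blast
  have "S \<in> hat_class M S"
    unfolding hat_class_def using S normal_imp_subgroup[OF Ctbl_normal] by (intro rcos_self) (simp_all add: carrier_Aut)
  then have "S \<in> Ctbl M #>\<^bsub>Aut M\<^esub> \<gamma>" unfolding \<gamma>(2) unfolding hat_class_def .
  then obtain c where c: "c \<in> Ctbl M" "S = c \<otimes>\<^bsub>Aut M\<^esub> \<gamma>" by (auto simp: r_coset_def)
  show "S \<in> almost_full_group M T"
    using c \<gamma> subgroup.m_closed[OF subgroup_almost_full_group[OF T]] Ctbl_subset_almost_full_group by blast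
qed (auto simp: full_group_hat_eq)

lemma subgroup_full_group_hat:
  assumes "T \<in> borel_aut M"
  shows "subgroup (full_group_hat M T) (Aut_hat M)"
proof -
  have "hat_class M \<in> hom (Aut M) (Aut_hat M)"
    using normal.r_coset_hom_Mod[OF Ctbl_normal] by (simp add: hat_class_def[abs_def] Aut_hat_def)
  then interpret group_hom "Aut M" "Aut_hat M" "hat_class M"
    by (simp add: group_hom_def group_hom_axioms_def group_Aut group_Aut_hat)
  show ?thesis
    unfolding full_group_hat_eq by (rule subgroup_img_is_subgroup[OF subgroup_almost_full_group[OF assms]])
qed

section \<open>Closedness of the preimage and passage to the quotient\<close>

lemma closedin_tau_almost_full_group:
  assumes M: "standard_borel M" and T: "T \<in> borel_aut M"
  shows "closedin (tau M) (almost_full_group M T)"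
  unfolding closedin_def
proof
  show "almost_full_group M T \<subseteq> topspace (tau M)" by (auto simp: almost_full_group_def topspace_tau)
  show "openin (tau M) (topspace (tau M) - almost_full_group M T)"
  proof (subst openin_subopen, intro ballI)
    fix S assume "S \<in> topspace (tau M) - almost_full_group M T"
    then have S: "S \<in> borel_aut M" "uncountable (off_orbit M T S)"
      by (auto simp: topspace_tau almost_full_group_def)
    obtain \<mu> where \<mu>: "\<mu> \<in> prob_measures M" "measure \<mu> (off_orbit M T S) = 1"
      "\<And>C. countable C \<Longrightarrow> C \<subseteq> space M \<Longrightarrow> measure \<mu> C = 0"
      by (rule standard_borel_diffuse_measure[OF M off_orbit_sets[OF M T S(1)] S(2)]) blast
    interpret prob_space \<mu> using \<mu>(1) by (simp add: prob_measures_def)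
    have sets: "sets \<mu> = sets M" using \<mu>(1) by (simp add: prob_measures_def)
    have "R \<notin> almost_full_group M T" if R: "R \<in> tau_nbhd M S {\<mu>} 1" for R
    proof
      assume "R \<in> almost_full_group M T"
      then have Rb: "R \<in> borel_aut M" and c: "countable (off_orbit M T R)"
        by (auto simp: almost_full_group_def)
      \<comment> \<open>Where \<open>R\<close> and \<open>S\<close> agree, both leave the orbit or
        neither does. The first set on the right is countable, hence null, and the second has
        measure below 1, while the left side has measure 1.\<close>
      have "off_orbit M T S \<subseteq> off_orbit M T R \<union> diff_set M R S"
        by (auto simp: off_orbit_def diff_set_def)
      then have "measure \<mu> (off_orbit M T S) \<le> measure \<mu> (off_orbit M T R \<union> diff_set M R S)"
        using off_orbit_sets[OF M T Rb] diff_set_sets[OF M Rb S(1)]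
        by (intro finite_measure_mono) (simp_all add: sets)
      also have "\<dots> \<le> measure \<mu> (off_orbit M T R) + measure \<mu> (diff_set M R S)"
        using off_orbit_sets[OF M T Rb] diff_set_sets[OF M Rb S(1)]
        by (intro measure_Un_le) (simp_all add: sets)
      also have "measure \<mu> (off_orbit M T R) = 0"
        using c by (rule \<mu>(3)) (auto simp: off_orbit_def)
      finally show False using R \<mu>(2) by (simp add: tau_nbhd_def)
    qed
    moreover have "S \<in> tau_nbhd M S {\<mu>} 1" using S by (simp add: tau_nbhd_def diff_set_def)
    moreover have "openin (tau M) (tau_nbhd M S {\<mu>} 1)"
      unfolding tau_def
    proof (rule topology_generated_by_Basis, intro CollectI exI conjI)
      show "tau_nbhd M S {\<mu>} 1 = tau_nbhd M S {\<mu>} 1" ..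
    qed (use S \<mu>(1) in simp_all)
    moreover have "tau_nbhd M S {\<mu>} 1 \<subseteq> topspace (tau M)" by (auto simp: tau_nbhd_def topspace_tau)
    ultimately show "\<exists>U. openin (tau M) U \<and> S \<in> U \<and> U \<subseteq> topspace (tau M) - almost_full_group M T"
      by blast
  qed
qed

text \<open>Under a quotient map a set is closed exactly if its preimage is, and the preimage here
  is \<open>almost_full_group M T\<close>.\<close>

lemma closedin_tau_hat_full_group_hat:
  assumes M: "standard_borel M" and T: "T \<in> borel_aut M"
  shows "closedin (tau_hat M) (full_group_hat M T)"
proof -
  have "full_group_hat M T \<subseteq> topspace (tau_hat M)"
    using subgroup.subset[OF subgroup_full_group_hat[OF T]] by (simp add: topspace_tau_hat)
  moreover have "{S \<in> topspace (tau M). hat_class M S \<in> full_group_hat M T} = almost_full_group M T"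
    using hat_class_mem_full_group_hat_iff[OF T] by (auto simp: topspace_tau almost_full_group_def)
  ultimately show ?thesis
    using closedin_tau_almost_full_group[OF M T] quotient_map_quotient_topology[of "tau M" "hat_class M",
        unfolded quotient_map_closedin, THEN conjunct2, rule_format, of "full_group_hat M T"]
    by (simp only: tau_hat_def)
qed

theorem proposition2p2:
  fixes M :: "'a measure"
  assumes "standard_borel M" and "uncountable (space M)"
  shows "(\<forall>T\<in>carrier (Aut M).
            closedin (tau M) (full_group M T) \<and>
            closedin (tau' M) (full_group M T) \<and>
            closedin (tau'' M) (full_group M T) \<and>
            closedin (p_top M) (full_group M T) \<and>
            closedin (p_tilde M) (full_group M T) \<and>
            closedin (p_bar M) (full_group M T)) \<and>
         (\<forall>C\<in>carrier (Aut_hat M). \<forall>T\<in>C.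
            subgroup (full_group_hat M T) (Aut_hat M) \<and>
            closedin (tau_hat M) (full_group_hat M T))"
proof -
  have "space M \<noteq> {}" using assms(2) by auto
  \<comment> \<open>The class \<open>C\<close> is a coset in the automorphism group, so each of its
    representatives \<open>T\<close> is an automorphism.\<close>
  moreover have "T \<in> borel_aut M" if C: "C \<in> carrier (Aut_hat M)" and T: "T \<in> C" for C T
  proof -
    obtain S where S: "S \<in> borel_aut M" "C = hat_class M S" using C by (auto simp: carrier_Aut_hat)
    have "C \<subseteq> carrier (Aut M)"
      unfolding S(2) hat_class_def using S(1)
      by (intro monoid.r_coset_subset_G[OF group.is_monoid[OF group_Aut]]) (auto simp: carrier_Aut Ctbl_def)
    then show ?thesis using T by (auto simp: carrier_Aut)
  qed
  ultimately show ?thesis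
    using assms(1) closedin_tau_full_group closedin_tau'_full_group closedin_tau''_full_group
      closedin_p_top_full_group closedin_p_tilde_full_group closedin_p_bar_full_group
      subgroup_full_group_hat closedin_tau_hat_full_group_hat
    by meson
qed

end
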